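(* Let $0<p<1/2$, $f\in H_p$ and let the sequence $\{q_k:k\in\mathbb N\}$ be non-decreasing. Then there exists an absolute constant $c_p$, depending only on $p$, such that $$\sum_{k=1}^{\infty}\frac{\|t_kf\|_p^p}{k^{2-2p}}\le c_p\|f\|_{H_p}^p .$$
   Context: $\mathbb N_+$ is the set of positive integers, $\mathbb N=\mathbb N_+\cup\{0\}$. Fix a bounded sequence $m=(m_0,m_1,\dots)$ of integers $m_k\ge 2$. $G_m=\prod_{k\ge0}Z_{m_k}$, where $Z_{m_k}=\{0,\dots,m_k-1\}$ is the additive group modulo $m_k$, with the product of the discrete topologies; $\mu$ is the Haar measure with $\mu(G_m)=1$. $M_0:=1$, $M_{k+1}:=m_kM_k$; every $n\in\mathbb N$ is uniquely $n=\sum_{j\ge0}n_jM_j$ with $n_j\in Z_{m_j}$. $r_k(x):=\exp(2\pi i x_k/m_k)$, $\psi_n:=\prod_{k\ge0}r_k^{n_k}$ (Vilenkin system). $I_0(x):=G_m$, $I_n(x):=\{y: y_0=x_0,\dots,y_{n-1}=x_{n-1}\}$; $\mathcal F_n$ is the $\sigma$-algebra generated by $\{I_n(x):x\in G_m\}$. For $g\in L_1(G_m)$: $\widehat g(k):=\int g\overline{\psi_k}\,d\mu$, $S_ng:=\sum_{k=0}^{n-1}\widehat g(k)\psi_k$. A martingale is a sequence $f=(f^{(n)}:n\in\mathbb N)$ of integrable functions with $f^{(n)}$ $\mathcal F_n$-measurable and $S_{M_n}f^{(k)}=f^{(n)}$ for $n\le k$; $f^*:=\sup_n|f^{(n)}|$;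 $H_p$ is the set of martingales with $\|f\|_{H_p}:=\|f^*\|_p<\infty$, where $\|g\|_p:=(\int|g|^pd\mu)^{1/p}$. For a martingale, $\widehat f(i):=\lim_k\int f^{(k)}\overline{\psi_i}\,d\mu$ and $S_nf:=\sum_{k=0}^{n-1}\widehat f(k)\psi_k$. For a sequence $\{q_k:k\in\mathbb N\}$ of nonnegative numbers, $Q_n:=\sum_{k=0}^{n-1}q_k$ and the Nörlund means are $t_nf:=\frac1{Q_n}\sum_{k=1}^nq_{n-k}S_kf$ ($n\in\mathbb N_+$); it is always assumed that $q_0>0$ and $Q_n\to\infty$. The sequence $m$ is fixed, and "absolute" constants may depend on it. *)

theory Defs
  imports "HOL-Probability.Probability"
begin

definition Gm :: "(nat \<Rightarrow> nat) \<Rightarrow> (nat \<Rightarrow> nat) set" where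
  "Gm m = (\<Pi>\<^sub>E k\<in>UNIV. {..<m k})"

definition Gm_topology :: "(nat \<Rightarrow> nat) \<Rightarrow> (nat \<Rightarrow> nat) topology" where
  "Gm_topology m = product_topology (\<lambda>k. discrete_topology {..<m k}) UNIV"

definition Gm_add :: "(nat \<Rightarrow> nat) \<Rightarrow> (nat \<Rightarrow> nat) \<Rightarrow> (nat \<Rightarrow> nat) \<Rightarrow> nat \<Rightarrow> nat" where
  "Gm_add m x y = (\<lambda>k. (x k + y k) mod m k)"

text \<open>Normalised Haar measure: the translation-invariant Borel probability measure. Regularity
  need not be required, since the group is compact and metrizable.\<close>

definition normalized_haar :: "(nat \<Rightarrow> nat) \<Rightarrow> (nat \<Rightarrow> nat) measure \<Rightarrow> bool" where
  "normalized_haar m \<mu> \<longleftrightarrow>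
     space \<mu> = Gm m \<and>
     sets \<mu> = sigma_sets (Gm m) {U. openin (Gm_topology m) U} \<and>
     emeasure \<mu> (Gm m) = 1 \<and>
     (\<forall>a\<in>Gm m. \<forall>A\<in>sets \<mu>. emeasure \<mu> (Gm_add m a ` A) = emeasure \<mu> A)"

primrec MM :: "(nat \<Rightarrow> nat) \<Rightarrow> nat \<Rightarrow> nat" where
  "MM m 0 = 1"
| "MM m (Suc k) = m k * MM m k"

text \<open>The \<open>j\<close>-th digit of \<open>n\<close> in the mixed-radix expansion with weights \<open>MM m j\<close>; see the lemmas
  \<open>digit_expansion\<close> and \<open>digit_unique\<close> below.\<close>

definition digit :: "(nat \<Rightarrow> nat) \<Rightarrow> nat \<Rightarrow> nat \<Rightarrow> nat" where
  "digit m n j = (n div MM m j) mod m j"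

lemma MM_pos: "(\<And>k. m k > 0) \<Longrightarrow> MM m k > 0"
  by (induction k) auto

lemma digit_less: "(\<And>k. m k > 0) \<Longrightarrow> digit m n j < m j"
  by (simp add: digit_def)

lemma digit_sum_mod: "(\<Sum>j<N. digit m n j * MM m j) = n mod MM m N"
proof (induction N)
  case (Suc N)
  have "n mod MM m (Suc N) = MM m N * (n div MM m N mod m N) + n mod MM m N"
    by (simp add: mod_mult2_eq mult.commute[of "m N"])
  then show ?case
    using Suc by (simp add: digit_def mult.commute)
qed simp

lemma digit_expansion: "n < MM m N \<Longrightarrow> n = (\<Sum>j<N. digit m n j * MM m j)"
  by (simp add: digit_sum_mod)

lemma digit_unique:
  assumes "\<And>i. i < N \<Longrightarrow> d i < m i" and "j < N"
  shows "digit m (\<Sum>i<N. d i * MM m i) j = d j"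
proof -
  have less: "(\<Sum>i<n. d i * MM m i) < MM m n" if "n \<le> N" for n
    using that
  proof (induction n)
    case (Suc n)
    have "(\<Sum>i<Suc n. d i * MM m i) < d n * MM m n + MM m n"
      using Suc by simp
    also have "\<dots> = Suc (d n) * MM m n"
      by simp
    also have "\<dots> \<le> m n * MM m n"
      using Suc.prems assms(1)[of n] by (intro mult_right_mono) auto
    finally show ?case by simp
  qed simp
  have dvd: "MM m a dvd MM m b" if "a \<le> b" for a b
    using that by (induction rule: dec_induct) auto
  have "\<exists>c. (\<Sum>i<n. d i * MM m i) = (\<Sum>i<Suc j. d i * MM m i) + c * MM m (Suc j)"
    if "Suc j \<le> n" for n
    using that
  proof (induction rule: dec_induct)
    case base
    show ?case by (rule exI[of _ 0]) simp
  next
    case (step n)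
    then obtain c where c: "(\<Sum>i<n. d i * MM m i) = (\<Sum>i<Suc j. d i * MM m i) + c * MM m (Suc j)"
      by blast
    obtain e where e: "MM m n = MM m (Suc j) * e"
      using dvd[OF step(1)] by (elim dvdE)
    show ?case
      by (rule exI[of _ "c + d n * e"]) (simp only: sum.lessThan_Suc[of _ n] c, simp add: e algebra_simps)
  qed
  then obtain c where c: "(\<Sum>i<N. d i * MM m i) = (\<Sum>i<Suc j. d i * MM m i) + c * MM m (Suc j)"
    using assms(2) by (meson Suc_leI)
  have "(\<Sum>i<N. d i * MM m i) = (\<Sum>i<j. d i * MM m i) + (d j + c * m j) * MM m j"
    unfolding c by (simp add: algebra_simps)
  moreover have "(\<Sum>i<j. d i * MM m i) < MM m j"
    using less[of j] assms(2) by simp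
  ultimately have "(\<Sum>i<N. d i * MM m i) div MM m j = d j + c * m j"
    by simp
  then show ?thesis
    using assms by (simp add: digit_def)
qed

definition rademacher :: "(nat \<Rightarrow> nat) \<Rightarrow> nat \<Rightarrow> (nat \<Rightarrow> nat) \<Rightarrow> complex" where
  "rademacher m k x = exp (2 * of_real pi * \<i> * of_nat (x k) / of_nat (m k))"

definition psi :: "(nat \<Rightarrow> nat) \<Rightarrow> nat \<Rightarrow> (nat \<Rightarrow> nat) \<Rightarrow> complex" where
  "psi m n x = (\<Prod>k. rademacher m k x ^ digit m n k)"

definition fourier_coeff ::
  "(nat \<Rightarrow> nat) \<Rightarrow> (nat \<Rightarrow> nat) measure \<Rightarrow> ((nat \<Rightarrow> nat) \<Rightarrow> complex) \<Rightarrow> nat \<Rightarrow> complex" where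
  "fourier_coeff m \<mu> g k = (LINT x|\<mu>. g x * cnj (psi m k x))"

definition partial_sum ::
  "(nat \<Rightarrow> nat) \<Rightarrow> (nat \<Rightarrow> nat) measure \<Rightarrow> nat \<Rightarrow> ((nat \<Rightarrow> nat) \<Rightarrow> complex) \<Rightarrow> (nat \<Rightarrow> nat) \<Rightarrow> complex" where
  "partial_sum m \<mu> n g x = (\<Sum>k<n. fourier_coeff m \<mu> g k * psi m k x)"

definition cell :: "(nat \<Rightarrow> nat) \<Rightarrow> nat \<Rightarrow> (nat \<Rightarrow> nat) \<Rightarrow> (nat \<Rightarrow> nat) set" where
  "cell m n x = {y \<in> Gm m. \<forall>k<n. y k = x k}"

definition filtr :: "(nat \<Rightarrow> nat) \<Rightarrow> nat \<Rightarrow> (nat \<Rightarrow> nat) measure" where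
  "filtr m n = sigma (Gm m) (cell m n ` Gm m)"

text \<open>Both sides of the last condition are constant on the sets \<open>cell m k x\<close>, which have positive
  measure, so that equality almost everywhere and equality everywhere agree.\<close>

definition is_martingale ::
  "(nat \<Rightarrow> nat) \<Rightarrow> (nat \<Rightarrow> nat) measure \<Rightarrow> (nat \<Rightarrow> (nat \<Rightarrow> nat) \<Rightarrow> complex) \<Rightarrow> bool" where
  "is_martingale m \<mu> f \<longleftrightarrow>
     (\<forall>n. integrable \<mu> (f n) \<and> f n \<in> borel_measurable (filtr m n)) \<and>
     (\<forall>n k. n \<le> k \<longrightarrow> (\<forall>x\<in>Gm m. partial_sum m \<mu> (MM m n) (f k) x = f n x))"

definition maximal_fun :: "(nat \<Rightarrow> (nat \<Rightarrow> nat) \<Rightarrow> complex) \<Rightarrow> (nat \<Rightarrow> nat) \<Rightarrow> ennreal" where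
  "maximal_fun f x = (SUP n. ennreal (norm (f n x)))"

text \<open>Powers (with positive exponent) and \<open>L\<^sub>p\<close> quasi-norms with values in \<open>[0,\<infinity>]\<close>.\<close>

definition epowr :: "ennreal \<Rightarrow> real \<Rightarrow> ennreal" where
  "epowr a s = (if a = \<infinity> then \<infinity> else ennreal (enn2real a powr s))"

definition Lp_enorm :: "'a measure \<Rightarrow> real \<Rightarrow> ('a \<Rightarrow> ennreal) \<Rightarrow> ennreal" where
  "Lp_enorm \<mu> p g = epowr (\<integral>\<^sup>+x. epowr (g x) p \<partial>\<mu>) (1 / p)"

definition Lp_norm :: "'a measure \<Rightarrow> real \<Rightarrow> ('a \<Rightarrow> complex) \<Rightarrow> ennreal" where
  "Lp_norm \<mu> p g = Lp_enorm \<mu> p (\<lambda>x. ennreal (norm (g x)))"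

definition Hp_norm ::
  "(nat \<Rightarrow> nat) measure \<Rightarrow> real \<Rightarrow> (nat \<Rightarrow> (nat \<Rightarrow> nat) \<Rightarrow> complex) \<Rightarrow> ennreal" where
  "Hp_norm \<mu> p f = Lp_enorm \<mu> p (maximal_fun f)"

definition Hp ::
  "(nat \<Rightarrow> nat) \<Rightarrow> (nat \<Rightarrow> nat) measure \<Rightarrow> real \<Rightarrow> (nat \<Rightarrow> (nat \<Rightarrow> nat) \<Rightarrow> complex) set" where
  "Hp m \<mu> p = {f. is_martingale m \<mu> f \<and> Hp_norm \<mu> p f < \<infinity>}"

definition mart_coeff ::
  "(nat \<Rightarrow> nat) \<Rightarrow> (nat \<Rightarrow> nat) measure \<Rightarrow> (nat \<Rightarrow> (nat \<Rightarrow> nat) \<Rightarrow> complex) \<Rightarrow> nat \<Rightarrow> complex" where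
  "mart_coeff m \<mu> f i = lim (\<lambda>k. LINT x|\<mu>. f k x * cnj (psi m i x))"

definition mart_partial_sum ::
  "(nat \<Rightarrow> nat) \<Rightarrow> (nat \<Rightarrow> nat) measure \<Rightarrow> nat \<Rightarrow> (nat \<Rightarrow> (nat \<Rightarrow> nat) \<Rightarrow> complex) \<Rightarrow> (nat \<Rightarrow> nat) \<Rightarrow> complex" where
  "mart_partial_sum m \<mu> n f x = (\<Sum>k<n. mart_coeff m \<mu> f k * psi m k x)"

definition QQ :: "(nat \<Rightarrow> real) \<Rightarrow> nat \<Rightarrow> real" where
  "QQ q n = (\<Sum>k<n. q k)"

definition norlund_mean ::
  "(nat \<Rightarrow> nat) \<Rightarrow> (nat \<Rightarrow> nat) measure \<Rightarrow> (nat \<Rightarrow> real) \<Rightarrow> nat \<Rightarrow> (nat \<Rightarrow> (nat \<Rightarrow> nat) \<Rightarrow> complex)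
     \<Rightarrow> (nat \<Rightarrow> nat) \<Rightarrow> complex" where
  "norlund_mean m \<mu> q n f x =
     (1 / of_real (QQ q n)) * (\<Sum>k=1..n. of_real (q (n - k)) * mart_partial_sum m \<mu> k f x)"

lemma normalized_haar_PiM:
  assumes m: "\<And>k. m k > 0"
  shows "normalized_haar m (PiM UNIV (\<lambda>k. uniform_count_measure {..<m k}))"
proof -
  define U where "U = (\<lambda>k. uniform_count_measure {..<m k})"
  define P where "P = PiM UNIV U"
  have sets_U: "sets (U k) = Pow {..<m k}" and space_U: "space (U k) = {..<m k}" for k
    by (simp_all add: U_def sets_uniform_count_measure space_uniform_count_measure)
  have prob_U: "prob_space (U k)" for k
    unfolding U_def using m[of k] by (intro prob_space_uniform_count_measure) auto
  interpret product_prob_space U UNIV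
    by (intro product_prob_spaceI prob_U)
  have space_P: "space P = Gm m"
    by (simp add: P_def Gm_def space_PiM space_U)
  have Gm_iff: "x \<in> Gm m \<longleftrightarrow> (\<forall>k. x k < m k)" for x
    by (auto simp: Gm_def PiE_iff)
  have top: "topspace (Gm_topology m) = Gm m"
    by (simp add: Gm_topology_def Gm_def)
  have subU: "{V. openin (Gm_topology m) V} \<subseteq> Pow (Gm m)"
    using openin_subset top by fastforce

  have cell_sets: "cell m n x \<in> sets P" for n x
  proof -
    have "cell m n x = (\<Inter>k<n. {y\<in>space P. y k \<in> {x k} \<inter> {..<m k}}) \<inter> space P"
      by (auto simp: cell_def space_P Gm_iff)
    moreover have "{y\<in>space P. y k \<in> {x k} \<inter> {..<m k}} \<in> sets P" for k
      unfolding P_def by (rule sets_Collect_single) (auto simp: sets_U)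
    ultimately show ?thesis
      by (auto intro!: sets.countable_INT'' sets.Int)
  qed
  have fin_cells: "finite (cell m n ` Gm m)" for n
  proof -
    have "cell m n ` Gm m \<subseteq> cell m n ` (\<Pi>\<^sub>E k\<in>{..<n}. {..<m k})"
    proof
      fix C assume "C \<in> cell m n ` Gm m"
      then obtain x where x: "x \<in> Gm m" "C = cell m n x" by blast
      then have "C = cell m n (restrict x {..<n})" by (auto simp: cell_def)
      moreover have "restrict x {..<n} \<in> (\<Pi>\<^sub>E k\<in>{..<n}. {..<m k})"
        using x by (auto simp: Gm_iff)
      ultimately show "C \<in> cell m n ` (\<Pi>\<^sub>E k\<in>{..<n}. {..<m k})" by blast
    qed
    then show ?thesis
      by (rule finite_subset) (intro finite_imageI finite_PiE, auto)
  qed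
  have open_sets: "V \<in> sets P" if V: "openin (Gm_topology m) V" for V
  proof -
    have "\<exists>n. cell m n x \<subseteq> V" if "x \<in> V" for x
    proof -
      obtain X where X: "x \<in> Pi\<^sub>E UNIV X" "finite {i. X i \<noteq> {..<m i}}" "Pi\<^sub>E UNIV X \<subseteq> V"
        using product_topology_open_contains_basis[OF V[unfolded Gm_topology_def] \<open>x \<in> V\<close>] by auto
      obtain n where n: "\<forall>i\<in>{i. X i \<noteq> {..<m i}}. i < n"
        using X(2) by (meson finite_nat_set_iff_bounded)
      have "y i \<in> X i" if "y \<in> cell m n x" for y i
        using n that X(1) by (cases "i < n") (auto simp: cell_def Gm_iff PiE_iff)
      then have "cell m n x \<subseteq> Pi\<^sub>E UNIV X"
        by (auto simp: PiE_iff)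
      with X(3) show ?thesis by blast
    qed
    then have ex: "\<exists>n. cell m n x \<subseteq> V" if "x \<in> V" for x
      using that by blast
    have VG: "V \<subseteq> Gm m"
      using openin_subset[OF V] top by simp
    define W where "W = (\<lambda>n. \<Union>{C \<in> cell m n ` Gm m. C \<subseteq> V})"
    have "V \<subseteq> (\<Union>n. W n)"
    proof
      fix x assume x: "x \<in> V"
      then obtain n where "cell m n x \<subseteq> V" using ex by blast
      moreover have "x \<in> Gm m" "x \<in> cell m n x" using x VG by (auto simp: cell_def)
      ultimately have "x \<in> W n" unfolding W_def by blast
      then show "x \<in> (\<Union>n. W n)" by blast
    qed
    moreover have "(\<Union>n. W n) \<subseteq> V"
      unfolding W_def by blast
    moreover have "W n \<in> sets P" for n
      unfolding W_def using fin_cells[of n] cell_sets by (intro sets.finite_Union) auto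
    then have "(\<Union>n. W n) \<in> sets P"
      by (intro sets.countable_UN) auto
    ultimately show ?thesis by (metis subset_antisym)
  qed
  have sets_P: "sets P = sigma_sets (Gm m) {V. openin (Gm_topology m) V}"
  proof (rule antisym)
    have "{x \<in> Gm m. x i \<in> A} \<in> {V. openin (Gm_topology m) V}" if "A \<in> sets (U i)" for i A
      using openin_continuous_map_preimage[OF continuous_map_product_projection, of i UNIV
          "\<lambda>k. discrete_topology {..<m k}" A] that
      by (simp add: sets_U Gm_topology_def Gm_def)
    then show "sets P \<subseteq> sigma_sets (Gm m) {V. openin (Gm_topology m) V}"
      using sets_PiM_in_sets[of "sigma (Gm m) {V. openin (Gm_topology m) V}" UNIV U] subU
      by (auto simp: P_def space_U Gm_def[symmetric] sets_measure_of space_measure_of_conv)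
    show "sigma_sets (Gm m) {V. openin (Gm_topology m) V} \<subseteq> sets P"
      using open_sets by (subst space_P[symmetric], intro sets.sigma_sets_subset) auto
  qed
  have one: "emeasure P (Gm m) = 1"
    using P.emeasure_space_1 by (simp add: P_def[symmetric] space_P)

  have meas: "Gm_add m b \<in> measurable P P" for b
  proof -
    have "Gm_add m b \<in> measurable P (PiM UNIV U)"
    proof (rule measurable_PiM_single')
      fix k
      have "(\<lambda>j. (b k + j) mod m k) \<in> measurable (U k) (U k)"
        using m[of k] by (auto simp: measurable_def sets_U space_U)
      then have "(\<lambda>x. (b k + x k) mod m k) \<in> measurable (PiM UNIV U) (U k)"
        by (rule measurable_PiM_component_rev[rotated]) simp
      then show "(\<lambda>x. Gm_add m b x k) \<in> measurable P (U k)"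
        by (simp add: Gm_add_def P_def)
    qed (use m in \<open>auto simp: Gm_add_def space_U\<close>)
    then show ?thesis by (simp add: P_def)
  qed
  have shift1: "emeasure (U k) {j \<in> {..<m k}. (c + j) mod m k \<in> F} = emeasure (U k) F"
    if F: "F \<subseteq> {..<m k}" for c k F
  proof -
    let ?g = "\<lambda>j. (c + j) mod m k"
    have "inj_on ?g {..<m k}"
    proof (rule inj_onI)
      fix i j assume ij: "i \<in> {..<m k}" "j \<in> {..<m k}" "?g i = ?g j"
      have "v = u" if "u \<le> v" "v < m k" "?g v = ?g u" for u v
      proof -
        have "m k dvd (c + v) - (c + u)"
          using that by (subst mod_eq_dvd_iff_nat[symmetric]) auto
        then have "m k dvd v - u" by simp
        with that show "v = u" using dvd_imp_le[of "m k" "v - u"] by (cases "v = u") auto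
      qed
      with ij show "i = j"
        by (metis lessThan_iff nat_le_linear)
    qed
    moreover have "?g ` {..<m k} \<subseteq> {..<m k}" using m[of k] by auto
    ultimately have bij: "bij_betw ?g {..<m k} {..<m k}"
      by (simp add: bij_betw_def endo_inj_surj)
    have "bij_betw ?g {j \<in> {..<m k}. ?g j \<in> F} F"
    proof (rule bij_betw_subset[OF bij])
      show "?g ` {j \<in> {..<m k}. ?g j \<in> F} = F"
      proof
        show "F \<subseteq> ?g ` {j \<in> {..<m k}. ?g j \<in> F}"
        proof
          fix i assume "i \<in> F"
          then have "i \<in> ?g ` {..<m k}" using F bij by (auto simp: bij_betw_def)
          with \<open>i \<in> F\<close> show "i \<in> ?g ` {j \<in> {..<m k}. ?g j \<in> F}" by blast
        qed
      qed blast
    qed blast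
    then have "card {j \<in> {..<m k}. ?g j \<in> F} = card F"
      by (rule bij_betw_same_card)
    then show ?thesis
      using F emeasure_uniform_count_measure[of "{..<m k}" "{j \<in> {..<m k}. ?g j \<in> F}"]
      by (simp add: U_def emeasure_uniform_count_measure subset_eq)
  qed
  have distr: "distr P P (Gm_add m b) = P" for b
    unfolding P_def
  proof (rule PiM_eq)
    fix J :: "nat set" and F assume J: "finite J" and F: "\<And>j. j \<in> J \<Longrightarrow> F j \<in> sets (U j)"
    have "emeasure (distr P P (Gm_add m b)) (prod_emb UNIV U J (Pi\<^sub>E J F))
        = emeasure P (Gm_add m b -` prod_emb UNIV U J (Pi\<^sub>E J F) \<inter> space P)"
      using F J by (intro emeasure_distr meas) (auto simp: P_def intro!: sets_PiM_I)
    also have "Gm_add m b -` prod_emb UNIV U J (Pi\<^sub>E J F) \<inter> space P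
        = prod_emb UNIV U J (\<Pi>\<^sub>E j\<in>J. {i \<in> {..<m j}. (b j + i) mod m j \<in> F j})"
      using m by (auto simp: prod_emb_def space_P Gm_def space_U Gm_add_def PiE_iff restrict_def
          extensional_def)
    also have "emeasure P \<dots> = (\<Prod>j\<in>J. emeasure (U j) {i \<in> {..<m j}. (b j + i) mod m j \<in> F j})"
      unfolding P_def using J by (intro emeasure_PiM_emb) (auto simp: sets_U)
    also have "\<dots> = (\<Prod>j\<in>J. emeasure (U j) (F j))"
      using F by (intro prod.cong refl shift1) (auto simp: sets_U)
    finally show "emeasure (distr (PiM UNIV U) (PiM UNIV U) (Gm_add m b)) (prod_emb UNIV U J (Pi\<^sub>E J F))
        = (\<Prod>j\<in>J. emeasure (U j) (F j))"
      by (simp add: P_def)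
  qed simp
  have "emeasure P (Gm_add m a ` A) = emeasure P A" if a: "a \<in> Gm m" and A: "A \<in> sets P" for a A
  proof -
    define b where "b = (\<lambda>k. m k - a k)"
    have ab: "Gm_add m b (Gm_add m a x) = x" "Gm_add m a (Gm_add m b x) = x" if "x \<in> Gm m" for x
    proof -
      have "(b k + (a k + x k) mod m k) mod m k = x k" "(a k + (b k + x k) mod m k) mod m k = x k" for k
      proof -
        have "a k < m k" "x k < m k" using a that by (auto simp: Gm_iff)
        then have "b k + (a k + x k) = m k + x k" "a k + (b k + x k) = m k + x k"
          by (auto simp: b_def)
        with \<open>x k < m k\<close> show "(b k + (a k + x k) mod m k) mod m k = x k"
          "(a k + (b k + x k) mod m k) mod m k = x k"
          by (simp_all only: mod_add_right_eq mod_add_self1 mod_less)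
      qed
      then show "Gm_add m b (Gm_add m a x) = x" "Gm_add m a (Gm_add m b x) = x"
        by (simp_all add: Gm_add_def)
    qed
    have "A \<subseteq> Gm m" using sets.sets_into_space[OF A] space_P by simp
    moreover have "Gm_add m c x \<in> Gm m" for c x
      using m by (simp add: Gm_iff Gm_add_def)
    ultimately have "Gm_add m a ` A = Gm_add m b -` A \<inter> space P"
      using ab by (force simp: space_P image_iff)
    then have "emeasure P (Gm_add m a ` A) = emeasure (distr P P (Gm_add m b)) A"
      using A meas by (simp add: emeasure_distr)
    then show ?thesis by (simp add: distr)
  qed
  then show ?thesis
    unfolding normalized_haar_def using space_P sets_P one by (simp add: P_def U_def)
qed

end

theory Submission
  imports Defs
begin

text \<open>For non-decreasing \<open>q\<close>, summation by parts turns \<open>t\<^sub>n f\<close> into a convex combination of the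
  Fejer means \<open>\<sigma>\<^sub>j f\<close> with \<open>j \<le> n\<close>. If \<open>s < A\<close> are the first two coordinates in which \<open>x\<close> and \<open>y\<close>
  differ, cancellation over blocks of length \<open>M\<^sub>s\<^sub>+\<^sub>1\<close> and \<open>M\<^sub>A\<^sub>+\<^sub>1\<close> bounds \<open>j K\<^sub>j(x - y)\<close> by a multiple of
  \<open>M\<^sub>s M\<^sub>A\<close>. So for \<open>j\<close> comparable to \<open>M\<^sub>L\<close>, \<open>j |\<sigma>\<^sub>j f(x)|\<close> is controlled by the integrals of \<open>|f\<^sup>(\<^sup>L\<^sup>)|\<close>
  over the sets where \<open>y\<^sub>i = x\<^sub>i\<close> for \<open>i < A\<close>, \<open>i \<noteq> s\<close>. No atomic decomposition is needed: on such a
  set \<open>J\<close> the Hardy-type inequality \<open>\<Sum>\<^sub>L M\<^sub>L\<^sup>p\<^sup>-\<^sup>1 (\<integral>\<^sub>J |f\<^sup>(\<^sup>L\<^sup>)|)\<^sup>p \<le> C \<integral>\<^sub>J (f\<^sup>*)\<^sup>p\<close>, \<open>L \<ge> A\<close>, holds because a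
  nonempty level set of \<open>|f\<^sup>(\<^sup>L\<^sup>)|\<close> has measure at least \<open>1 / M\<^sub>L\<close>. The remaining sum over \<open>A\<close> converges
  since \<open>2p - 1 < 0\<close>.\<close>

section \<open>Power sums\<close>

text \<open>After division by \<open>a + b\<close> both summands lie in \<open>[0,1]\<close>, where
  a number is at most its \<open>p\<close>-th power.\<close>

lemma powr_add_le_add_powr:
  fixes a b p :: real
  assumes "0 \<le> a" "0 \<le> b" "0 < p" "p \<le> 1"
  shows "(a + b) powr p \<le> a powr p + b powr p"
proof (cases "a + b = 0")
  case False
  then have s: "a + b > 0" using assms by linarith
  have le: "x \<le> x powr p" if "0 \<le> x" "x \<le> 1" for x :: real
    using that assms powr_mono'[of p 1 x] by (cases "x = 0") auto
  have "1 = a / (a + b) + b / (a + b)"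
    using s by (simp add: add_divide_distrib[symmetric])
  also have "\<dots> \<le> (a / (a + b)) powr p + (b / (a + b)) powr p"
    using assms s by (intro add_mono le) auto
  also have "\<dots> = (a powr p + b powr p) / (a + b) powr p"
    using assms s by (simp add: powr_divide add_divide_distrib)
  finally show ?thesis
    using s by (simp add: field_simps)
qed (use assms in auto)

lemma powr_sum_le_sum_powr:
  fixes a :: "'a \<Rightarrow> real"
  assumes "finite S" "\<And>i. i \<in> S \<Longrightarrow> 0 \<le> a i" "0 < p" "p \<le> 1"
  shows "(\<Sum>i\<in>S. a i) powr p \<le> (\<Sum>i\<in>S. a i powr p)"
  using assms(1,2)
proof (induction S rule: finite_induct)
  case (insert i S)
  have "(\<Sum>i\<in>insert i S. a i) powr p \<le> a i powr p + (\<Sum>i\<in>S. a i) powr p"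
    using insert assms by (simp add: powr_add_le_add_powr sum_nonneg)
  also have "\<dots> \<le> a i powr p + (\<Sum>i\<in>S. a i powr p)"
    using insert by (intro add_left_mono) auto
  finally show ?case using insert by simp
qed simp

text \<open>Distinct exponents make the left side a part of the geometric series.\<close>

lemma sum_power_inj_le:
  fixes r :: real
  assumes "finite S" "inj_on h S" "0 \<le> r" "r < 1"
  shows "(\<Sum>k\<in>S. r ^ h k) \<le> 1 / (1 - r)"
proof -
  have "(\<Sum>k\<in>S. r ^ h k) = (\<Sum>i\<in>h ` S. r ^ i)"
    using assms by (simp add: sum.reindex)
  also have "\<dots> \<le> (\<Sum>i. r ^ i)"
    using assms by (intro sum_le_suminf summable_geometric) auto
  finally show ?thesis
    using assms by (simp add: suminf_geometric)
qed

lemma power_powr_commute: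
  fixes x :: real
  assumes "0 \<le> x"
  shows "(x ^ n) powr a = (x powr a) ^ n"
  using assms by (induction n) (auto simp: powr_mult)

lemma doubling_mono:
  fixes c :: "nat \<Rightarrow> real"
  assumes "\<And>k. 2 * c k \<le> c (Suc k)" "k \<le> l"
  shows "c k * 2 ^ (l - k) \<le> c l"
  using assms(2)
proof (induction rule: dec_induct)
  case (step l)
  then show ?case
    using assms(1)[of l] by (simp add: Suc_diff_le mult.assoc)
qed simp

text \<open>Read downwards from \<open>Max S\<close>, the terms decay at least like powers of
  \<open>2 powr (-a)\<close>, so the top term, at most \<open>v powr a\<close>, controls the
  sum.\<close>

lemma sum_powr_doubling_le:
  fixes c :: "nat \<Rightarrow> real"
  assumes c: "\<And>k. 0 < c k" "\<And>k. 2 * c k \<le> c (Suc k)" and S: "finite S" "\<And>k. k \<in> S \<Longrightarrow> c k \<le> v"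
    and "0 < a" "0 \<le> v"
  shows "(\<Sum>k\<in>S. c k powr a) \<le> v powr a / (1 - 2 powr (-a))"
proof (cases "S = {}")
  case False
  have r: "2 powr (-a) < (1::real)"
    using assms by (intro powr_less_one) auto
  have inj: "inj_on (\<lambda>k. Max S - k) S"
    using S by (intro inj_on_inverseI[where g = "\<lambda>i. Max S - i"]) simp
  have le: "c k powr a \<le> v powr a * (2 powr (-a)) ^ (Max S - k)" if "k \<in> S" for k
  proof -
    have "c k * 2 ^ (Max S - k) \<le> v"
      using doubling_mono[of c k "Max S", OF c(2)] that False S by (meson Max_ge Max_in order_trans)
    then have "(c k * 2 ^ (Max S - k)) powr a \<le> v powr a"
      using less_imp_le[OF c(1)[of k]] \<open>0 < a\<close> by (intro powr_mono2) auto
    moreover have one: "(2 ^ n) powr a * (2 powr (-a)) ^ n = (1::real)" for n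
      by (simp add: power_powr_commute power_mult_distrib[symmetric] flip: powr_add)
    ultimately have "c k powr a * (2 ^ (Max S - k)) powr a * (2 powr (-a)) ^ (Max S - k)
        \<le> v powr a * (2 powr (-a)) ^ (Max S - k)"
      using less_imp_le[OF c(1)[of k]] by (intro mult_right_mono) (auto simp: powr_mult)
    then show ?thesis
      using one[of "Max S - k"] by (simp add: mult.assoc)
  qed
  have "(\<Sum>k\<in>S. c k powr a) \<le> (\<Sum>k\<in>S. v powr a * (2 powr (-a)) ^ (Max S - k))"
    using le by (rule sum_mono)
  also have "\<dots> \<le> v powr a * (1 / (1 - 2 powr (-a)))"
    using r S inj by (subst sum_distrib_left[symmetric], intro mult_left_mono sum_power_inj_le) auto
  finally show ?thesis by simp
qed (use assms in \<open>auto intro!: divide_nonneg_nonneg less_imp_le[OF powr_less_one]\<close>)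

text \<open>The mirror image of \<open>sum_powr_doubling_le\<close>: negative powers decay
  geometrically upwards from \<open>Min S\<close>, so the first term controls the sum.\<close>

lemma sum_powr_neg_doubling_le:
  fixes c :: "nat \<Rightarrow> real"
  assumes c: "\<And>k. 2 * c k \<le> c (Suc k)" and S: "finite S" "\<And>k. k \<in> S \<Longrightarrow> v \<le> c k"
    and "0 < a" "0 < v"
  shows "(\<Sum>k\<in>S. c k powr (-a)) \<le> v powr (-a) / (1 - 2 powr (-a))"
proof (cases "S = {}")
  case False
  have r: "2 powr (-a) < (1::real)"
    using assms by (intro powr_less_one) auto
  have inj: "inj_on (\<lambda>k. k - Min S) S"
    using S by (intro inj_on_diff_nat) simp
  have le: "c k powr (-a) \<le> v powr (-a) * (2 powr (-a)) ^ (k - Min S)" if "k \<in> S" for k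
  proof -
    have "v * 2 ^ (k - Min S) \<le> c (Min S) * 2 ^ (k - Min S)"
      using False S by (intro mult_right_mono) auto
    also have "\<dots> \<le> c k"
      using doubling_mono[of c "Min S" k, OF c] that S by simp
    finally have "c k powr (-a) \<le> (v * 2 ^ (k - Min S)) powr (-a)"
      using assms by (intro powr_mono2') auto
    also have "\<dots> = v powr (-a) * (2 powr (-a)) ^ (k - Min S)"
      using assms by (simp add: powr_mult power_powr_commute)
    finally show ?thesis .
  qed
  have "(\<Sum>k\<in>S. c k powr (-a)) \<le> (\<Sum>k\<in>S. v powr (-a) * (2 powr (-a)) ^ (k - Min S))"
    using le by (rule sum_mono)
  also have "\<dots> \<le> v powr (-a) * (1 / (1 - 2 powr (-a)))"
    using r S inj by (subst sum_distrib_left[symmetric], intro mult_left_mono sum_power_inj_le) auto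
  finally show ?thesis by simp
qed (use assms in \<open>auto intro!: divide_nonneg_nonneg less_imp_le[OF powr_less_one]\<close>)

text \<open>The mean value theorem compares each term with a difference of consecutive values of
  \<open>n powr (-a)\<close>, and these telescope. The intermediate point is at most
  \<open>2 * n\<close>, which accounts for the factor \<open>2 powr (a + 1)\<close>.\<close>

lemma sum_powr_neg_tail_le:
  fixes a v :: real
  assumes a: "0 < a" and S: "finite S" "\<And>n. n \<in> S \<Longrightarrow> 0 < n \<and> v \<le> real n" and v: "0 < v"
  shows "(\<Sum>n\<in>S. real n powr (- a - 1)) \<le> 2 powr (a + 1) / a * v powr (-a)"
proof (cases "S = {}")
  case False
  have step: "real n powr (-a - 1) \<le> 2 powr (a + 1) / a * (real n powr (-a) - real (Suc n) powr (-a))"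
    if n: "0 < n" for n
  proof -
    have "\<exists>z>real n. z < real (Suc n) \<and>
        real (Suc n) powr (-a) - real n powr (-a) = (real (Suc n) - real n) * (-a * z powr (-a - 1))"
      using n by (intro MVT2) (auto intro!: has_real_derivative_powr[THEN DERIV_cong])
    then obtain z where z: "real n < z" "z < real (Suc n)"
        "real n powr (-a) - real (Suc n) powr (-a) = a * z powr (-a - 1)" by auto
    have "real n powr (-a - 1) = 2 powr (a + 1) * (2 * real n) powr (-a - 1)"
      using n by (simp add: powr_mult mult.assoc[symmetric] flip: powr_add)
    also have "\<dots> \<le> 2 powr (a + 1) * z powr (-a - 1)"
      using z n a by (intro mult_left_mono powr_mono2') auto
    finally show ?thesis using z a by simp
  qed
  have "(\<Sum>n\<in>S. real n powr (- a - 1)) \<le> (\<Sum>n=Min S..<Suc (Max S). real n powr (- a - 1))"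
    using S by (intro sum_mono2) (auto simp: less_Suc_eq_le)
  also have "\<dots> \<le> (\<Sum>n=Min S..<Suc (Max S). 2 powr (a + 1) / a * (real n powr (-a) - real (Suc n) powr (-a)))"
    using S False by (intro sum_mono step) (metis Min_in atLeastLessThan_iff gr0I leD)
  also have "\<dots> = 2 powr (a + 1) / a * (real (Min S) powr (-a) - real (Suc (Max S)) powr (-a))"
  proof -
    have "Min S \<le> Suc (Max S)" using S False by (meson Max_in Min_le le_SucI)
    then show ?thesis
      using sum_Suc_diff'[of "Min S" "Suc (Max S)" "\<lambda>n. - (real n powr (-a))"]
      by (subst sum_distrib_left[symmetric]) (simp del: of_nat_Suc sum.op_ivl_Suc)
  qed
  also have "\<dots> \<le> 2 powr (a + 1) / a * v powr (-a)"
  proof (intro mult_left_mono)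
    have "real (Min S) powr (-a) \<le> v powr (-a)"
      using S(2)[OF Min_in[OF S(1) False]] a v by (intro powr_mono2') auto
    then show "real (Min S) powr (-a) - real (Suc (Max S)) powr (-a) \<le> v powr (-a)"
      using powr_ge_zero[of "real (Suc (Max S))" "-a"] by linarith
  qed (use a in simp)
  finally show ?thesis .
qed (use a in auto)

section \<open>Summation by parts and dyadic level sets\<close>

lemma norm_weighted_sum_le:
  fixes s :: "nat \<Rightarrow> 'a :: real_normed_vector"
  assumes "\<And>i. 0 \<le> q i" "mono q" "\<And>j. 1 \<le> j \<Longrightarrow> j \<le> n \<Longrightarrow> norm (\<Sum>k=1..j. s k) \<le> real j * V"
  shows "norm (\<Sum>k=1..n. q (n - k) *\<^sub>R s k) \<le> QQ q n * V"
  using assms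
proof (induction n arbitrary: q)
  case (Suc n)
  \<comment> \<open>Summation by parts as an induction: \<open>q 0\<close> is split off every
    weight, and what remains is again nonnegative and non-decreasing. The term
    \<open>k = Suc n\<close> is left with weight zero, so the induction hypothesis for
    \<open>n\<close> applies, and the two bounds add up to exactly
    \<open>QQ q (Suc n) * V\<close>.\<close>
  define q' where "q' = (\<lambda>i. q (Suc i) - q 0)"
  have q0: "q 0 \<le> q i" for i
    using Suc.prems(2) by (simp add: monoD)
  have "mono q'"
    using Suc.prems(2) by (auto simp: q'_def mono_def)
  then have IH: "norm (\<Sum>k=1..n. q' (n - k) *\<^sub>R s k) \<le> QQ q' n * V"
    using Suc.prems(3) q0 by (intro Suc.IH) (auto simp: q'_def)
  have "(\<Sum>k=1..Suc n. q (Suc n - k) *\<^sub>R s k)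
      = (\<Sum>k=1..Suc n. (q (Suc n - k) - q 0) *\<^sub>R s k) + q 0 *\<^sub>R (\<Sum>k=1..Suc n. s k)"
    by (simp add: scaleR_sum_right sum.distrib[symmetric] scaleR_add_left[symmetric] del: sum.cl_ivl_Suc)
  also have "(\<Sum>k=1..Suc n. (q (Suc n - k) - q 0) *\<^sub>R s k) = (\<Sum>k=1..n. q' (n - k) *\<^sub>R s k)"
    by (auto simp: q'_def Suc_diff_le intro!: sum.cong)
  also have "norm (\<dots> + q 0 *\<^sub>R (\<Sum>k=1..Suc n. s k)) \<le> QQ q' n * V + q 0 * (real (Suc n) * V)"
    using Suc.prems(1)[of 0] Suc.prems(3)[of "Suc n"] IH
    by (intro order_trans[OF norm_triangle_ineq] add_mono) (auto intro!: mult_left_mono simp del: sum.cl_ivl_Suc)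
  also have "\<dots> = (q 0 + (\<Sum>k<n. q (Suc k))) * V"
    by (simp add: QQ_def q'_def sum_subtractf algebra_simps)
  also have "q 0 + (\<Sum>k<n. q (Suc k)) = QQ q (Suc n)"
    unfolding QQ_def by (rule sum.lessThan_Suc_shift[symmetric])
  finally show ?case .
qed (simp add: QQ_def)

text \<open>For \<open>x\<close> nonzero, the largest threshold \<open>2 ^ k / 2 ^ K\<close> below
  \<open>x\<close> is at least \<open>x / 2\<close>, so its term alone dominates \<open>x\<close>.
  The bounds on \<open>x\<close> guarantee that this threshold is among the first
  \<open>2 * K\<close>.\<close>

lemma le_sum_dyadic_levels:
  fixes x :: real
  assumes "0 \<le> x" "x \<le> 2 ^ K" "x = 0 \<or> 1 / 2 ^ K < x"
  shows "x \<le> (\<Sum>k<2 * K. 2 * (2 ^ k / 2 ^ K) * of_bool (2 ^ k / 2 ^ K < x))"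
proof (cases "x = 0")
  case False
  then have lower: "2 ^ 0 / 2 ^ K < x" using assms by simp
  have top: "x \<le> 2 ^ (2 * K) / 2 ^ K"
    using assms by (simp add: mult_2 power_add)
  define k where "k = (LEAST k. x \<le> 2 ^ Suc k / 2 ^ K)"
  have K: "K > 0" using lower assms(2) by (cases K) auto
  then have ex: "x \<le> 2 ^ Suc (2 * K - 1) / 2 ^ K" using top by simp
  have k: "x \<le> 2 ^ Suc k / 2 ^ K"
    unfolding k_def using ex by (rule LeastI)
  have "k < 2 * K"
    using Least_le[of "\<lambda>k. x \<le> 2 ^ Suc k / 2 ^ K", OF ex] K by (simp add: k_def)
  have "2 ^ k / 2 ^ K < x"
  proof (cases k)
    case (Suc j)
    then show ?thesis
      using not_less_Least[of j "\<lambda>k. x \<le> 2 ^ Suc k / 2 ^ K"] by (simp add: k_def)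
  qed (use lower in simp)
  then have "x \<le> 2 * (2 ^ k / 2 ^ K) * of_bool (2 ^ k / 2 ^ K < x)"
    using k by simp
  also have "\<dots> \<le> (\<Sum>k<2 * K. 2 * (2 ^ k / 2 ^ K) * of_bool (2 ^ k / 2 ^ K < x))"
    using \<open>k < 2 * K\<close> by (intro member_le_sum) auto
  finally show ?thesis .
qed (simp add: sum_nonneg)

text \<open>A nonempty level set of \<open>g L\<close> has mass at least \<open>1 / c L\<close>. Hence a level set of \<open>\<phi>\<close> of
  mass \<open>\<nu>\<close> meets only those \<open>L\<close> with \<open>c L \<ge> 1 / \<nu>\<close>, over which \<open>c L powr (p - 1)\<close> sums to
  \<open>O(\<nu> powr (1 - p))\<close>.\<close>

lemma sum_powr_average_le:
  fixes c :: "nat \<Rightarrow> real" and g :: "nat \<Rightarrow> 'a \<Rightarrow> real" and w p :: real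
  assumes p: "0 < p" "p < 1" and c: "\<And>k. 0 < c k" "\<And>k. 2 * c k \<le> c (Suc k)"
    and fin: "finite S" "finite I" and w: "0 \<le> w"
    and g: "\<And>L y. L \<in> S \<Longrightarrow> y \<in> I \<Longrightarrow> 0 \<le> g L y" "\<And>L y. L \<in> S \<Longrightarrow> y \<in> I \<Longrightarrow> g L y \<le> \<phi> y"
    and \<phi>: "\<And>y. y \<in> I \<Longrightarrow> 0 \<le> \<phi> y"
    and level: "\<And>L y. L \<in> S \<Longrightarrow> y \<in> I \<Longrightarrow> 1 / c L \<le> w * card {z \<in> I. g L z = g L y}"
  shows "(\<Sum>L\<in>S. c L powr (p - 1) * (w * (\<Sum>y\<in>I. g L y)) powr p)
    \<le> 2 powr p / (1 - 2 powr (p - 1)) / (1 - 2 powr (-p)) * (w * (\<Sum>y\<in>I. \<phi> y powr p))"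
proof -
  \<comment> \<open>Each single value lies in the dyadic window once \<open>K\<close> is large; as
    only finitely many values \<open>g L y\<close> occur, one \<open>K\<close> serves them
    all.\<close>
  have ev: "\<forall>\<^sub>F K in sequentially. x \<le> 2 ^ K \<and> (x = 0 \<or> 1 / 2 ^ K < x)" if "0 \<le> x" for x :: real
  proof -
    have "\<forall>\<^sub>F K in sequentially. x \<le> 2 ^ K"
      using filterlim_at_infinity_imp_norm_at_top[OF filterlim_realpow_sequentially_gt1[of "2::real"]]
      by (simp add: filterlim_at_top norm_power)
    moreover have "\<forall>\<^sub>F K in sequentially. x = 0 \<or> 1 / 2 ^ K < x"
    proof (cases "x = 0")
      case False
      have "(\<lambda>K. 1 / 2 ^ K) \<longlonglongrightarrow> (0::real)"
        using LIMSEQ_inverse_realpow_zero[of 2] by (simp add: inverse_eq_divide)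
      then have "\<forall>\<^sub>F K in sequentially. 1 / 2 ^ K < x"
        using False that by (intro order_tendstoD) auto
      then show ?thesis by (rule eventually_mono) simp
    qed simp
    ultimately show ?thesis by (rule eventually_conj)
  qed
  have "\<forall>\<^sub>F K in sequentially. \<forall>(L, y)\<in>S \<times> I. g L y \<le> 2 ^ K \<and> (g L y = 0 \<or> 1 / 2 ^ K < g L y)"
    using fin g by (intro eventually_ball_finite) (auto intro!: ev)
  then obtain K where K: "g L y \<le> 2 ^ K" "g L y = 0 \<or> 1 / 2 ^ K < g L y" if "L \<in> S" "y \<in> I" for L y
    by (force dest: eventually_happens)
  define t :: "nat \<Rightarrow> real" where "t k = 2 ^ k / 2 ^ K" for k
  have t: "0 < t k" "2 * t k \<le> t (Suc k)" for k by (simp_all add: t_def)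
  define E where "E L k = {y \<in> I. t k < g L y}" for L k
  define F where "F k = {y \<in> I. t k < \<phi> y}" for k
  have E_F: "w * card (E L k) \<le> w * card (F k)" if "L \<in> S" for L k
    using that fin w g unfolding E_def F_def
    by (intro mult_left_mono) (auto intro!: card_mono intro: less_le_trans)
  have D: "0 < 1 - (2::real) powr (p - 1)" "0 < 1 - (2::real) powr (-p)"
    using p powr_less_one[of 2 "p - 1"] powr_less_one[of 2 "-p"] by simp_all

  \<comment> \<open>Dyadic layers bound the sum by masses of level sets, and subadditivity of the
    \<open>p\<close>-th power separates the layers.\<close>
  have A: "(w * (\<Sum>y\<in>I. g L y)) powr p \<le> (\<Sum>k<2*K. (2 * t k) powr p * (w * card (E L k)) powr p)"
    if L: "L \<in> S" for L
  proof -
    have "(\<Sum>y\<in>I. g L y) \<le> (\<Sum>y\<in>I. \<Sum>k<2*K. 2 * t k * of_bool (t k < g L y))"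
      unfolding t_def using L g K by (intro sum_mono le_sum_dyadic_levels) auto
    also have "\<dots> = (\<Sum>k<2*K. 2 * t k * card (E L k))"
      using fin by (subst sum.swap)
        (simp add: sum_distrib_left[symmetric] E_def of_bool_def sum.If_cases Int_def)
    finally have "w * (\<Sum>y\<in>I. g L y) \<le> w * (\<Sum>k<2*K. 2 * t k * card (E L k))"
      using w by (rule mult_left_mono)
    then have "(w * (\<Sum>y\<in>I. g L y)) powr p \<le> (\<Sum>k<2*K. 2 * t k * (w * card (E L k))) powr p"
      using p w L g by (intro powr_mono2) (auto intro!: mult_nonneg_nonneg sum_nonneg simp: sum_distrib_left algebra_simps)
    also have "\<dots> \<le> (\<Sum>k<2*K. (2 * t k * (w * card (E L k))) powr p)"
      using p w t by (intro powr_sum_le_sum_powr) (auto intro!: mult_nonneg_nonneg less_imp_le[OF t(1)])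
    also have "\<dots> = (\<Sum>k<2*K. (2 * t k) powr p * (w * card (E L k)) powr p)"
      using w t(1) by (intro sum.cong refl powr_mult)
    finally show ?thesis .
  qed
  \<comment> \<open>At one height, the sum of the weights over \<open>L\<close> gives
    \<open>\<nu> powr (1 - p)\<close> and the masses of the sets \<open>E L k\<close> supply the
    missing \<open>\<nu> powr p\<close>. The result is linear in \<open>\<nu>\<close>, so the layers
    of \<open>\<phi>\<close> can be reassembled.\<close>
  have B: "(\<Sum>L\<in>S. c L powr (p - 1) * (w * card (E L k)) powr p) \<le> w * card (F k) / (1 - 2 powr (p - 1))" for k
  proof -
    define S' where "S' = {L \<in> S. E L k \<noteq> {}}"
    define \<nu> where "\<nu> = w * card (F k)"
    have "0 \<le> \<nu>" using w by (simp add: \<nu>_def)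
    have cL: "1 / c L \<le> \<nu>" if L: "L \<in> S'" for L
    proof -
      obtain y where y: "y \<in> I" "t k < g L y" using L by (auto simp: S'_def E_def)
      have "1 / c L \<le> w * card {z \<in> I. g L z = g L y}"
        using L y level by (auto simp: S'_def)
      also have "\<dots> \<le> w * card (E L k)"
        using y fin w by (intro mult_left_mono) (auto simp: E_def intro!: card_mono)
      also have "\<dots> \<le> \<nu>" using L E_F by (simp add: \<nu>_def S'_def)
      finally show ?thesis .
    qed
    have "(\<Sum>L\<in>S. c L powr (p - 1) * (w * card (E L k)) powr p)
        = (\<Sum>L\<in>S'. c L powr (p - 1) * (w * card (E L k)) powr p)"
      using fin by (intro sum.mono_neutral_right) (auto simp: S'_def)
    also have "\<dots> \<le> (\<Sum>L\<in>S'. c L powr (-(1 - p)) * \<nu> powr p)"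
      using w p E_F by (intro sum_mono mult_mono powr_mono2) (auto simp: S'_def \<nu>_def)
    also have "\<dots> \<le> \<nu> / (1 - 2 powr (p - 1))"
    proof (cases "S' = {}")
      case False
      then have \<nu>: "\<nu> > 0"
        using cL c(1) by (metis ex_in_conv less_le_trans zero_less_divide_1_iff)
      have "(\<Sum>L\<in>S'. c L powr (-(1 - p))) \<le> (1 / \<nu>) powr (-(1 - p)) / (1 - 2 powr (-(1 - p)))"
      proof (rule sum_powr_neg_doubling_le)
        show "1 / \<nu> \<le> c L" if "L \<in> S'" for L
          using cL[OF that] \<nu> c(1)[of L] by (simp add: field_simps)
      qed (use p \<nu> c fin in \<open>auto simp: S'_def\<close>)
      then have "(\<Sum>L\<in>S'. c L powr (-(1 - p)) * \<nu> powr p)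
          \<le> (1 / \<nu>) powr (-(1 - p)) / (1 - 2 powr (-(1 - p))) * \<nu> powr p"
        unfolding sum_distrib_right[symmetric] by (rule mult_right_mono) simp
      also have "(1 / \<nu>) powr (-(1 - p)) = \<nu> powr (1 - p)"
        using \<nu> by (simp add: powr_divide powr_minus powr_diff field_simps)
      also have "\<nu> powr (1 - p) / (1 - 2 powr (-(1 - p))) * \<nu> powr p = \<nu> / (1 - 2 powr (p - 1))"
        using \<nu> by (simp add: powr_add[symmetric])
      finally show ?thesis .
    qed (use D \<open>0 \<le> \<nu>\<close> in simp)
    finally show ?thesis by (simp add: \<nu>_def)
  qed
  have "(\<Sum>L\<in>S. c L powr (p - 1) * (w * (\<Sum>y\<in>I. g L y)) powr p)
      \<le> (\<Sum>L\<in>S. c L powr (p - 1) * (\<Sum>k<2*K. (2 * t k) powr p * (w * card (E L k)) powr p))"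
    using A by (intro sum_mono mult_left_mono) auto
  also have "\<dots> = (\<Sum>k<2*K. (2 * t k) powr p * (\<Sum>L\<in>S. c L powr (p - 1) * (w * card (E L k)) powr p))"
    unfolding sum_distrib_left by (subst sum.swap) (simp add: mult_ac)
  also have "\<dots> \<le> (\<Sum>k<2*K. (2 * t k) powr p * (w * card (F k) / (1 - 2 powr (p - 1))))"
    using B by (intro sum_mono mult_left_mono) auto
  also have "\<dots> = 2 powr p / (1 - 2 powr (p - 1)) * w * (\<Sum>k<2*K. t k powr p * card (F k))"
    using t(1) by (simp add: sum_distrib_left sum_divide_distrib powr_mult less_imp_le mult_ac)
  also have "(\<Sum>k<2*K. t k powr p * card (F k)) = (\<Sum>y\<in>I. \<Sum>k<2*K. t k powr p * of_bool (t k < \<phi> y))"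
    using fin by (subst sum.swap)
      (simp add: sum_distrib_left[symmetric] F_def of_bool_def sum.If_cases Int_def)
  also have "\<dots> = (\<Sum>y\<in>I. \<Sum>k\<in>{k. k < 2*K \<and> t k < \<phi> y}. t k powr p)"
    by (auto simp: of_bool_def sum.If_cases Int_def if_distrib cong: if_cong intro!: sum.cong)
  \<comment> \<open>For fixed \<open>y\<close> the heights below \<open>\<phi> y\<close> form a
    doubling sequence, so their \<open>p\<close>-th powers sum to at most a multiple of
    \<open>\<phi> y powr p\<close>.\<close>
  also have "2 powr p / (1 - 2 powr (p - 1)) * w * \<dots>
      \<le> 2 powr p / (1 - 2 powr (p - 1)) * w * (\<Sum>y\<in>I. \<phi> y powr p / (1 - 2 powr (-p)))"
    using D w p t \<phi> by (intro mult_left_mono sum_mono sum_powr_doubling_le) auto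
  also have "\<dots> = 2 powr p / (1 - 2 powr (p - 1)) / (1 - 2 powr (-p)) * (w * (\<Sum>y\<in>I. \<phi> y powr p))"
    by (simp add: sum_divide_distrib[symmetric])
  finally show ?thesis .
qed

section \<open>Character sums\<close>

text \<open>With \<open>u t\<close> the value of the \<open>t\<close>-th Rademacher function this is
  the Vilenkin function of index \<open>n < MM m N\<close>. Leaving \<open>m\<close> and
  \<open>u\<close> arbitrary lets both be shifted, so that factors between blocks are again of this
  form.\<close>

definition chi :: "nat \<Rightarrow> (nat \<Rightarrow> nat) \<Rightarrow> (nat \<Rightarrow> complex) \<Rightarrow> nat \<Rightarrow> complex" where
  "chi N m u n = (\<Prod>t<N. u t ^ digit m n t)"

lemma MM_add: "MM m (r + k) = MM m r * MM (\<lambda>t. m (r + t)) k"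
  by (induction k) (simp_all add: mult_ac)

lemma MM_dvd: "a \<le> b \<Longrightarrow> MM m a dvd MM m b"
  using MM_add[of m a "b - a"] by simp

lemma digit_add_low:
  assumes "t < r" "\<And>k. m k > 0"
  shows "digit m (b + a * MM m r) t = digit m b t"
proof -
  obtain e where e: "MM m r = MM m (Suc t) * e"
    using MM_dvd[of "Suc t" r m] assms by (auto elim: dvdE)
  have eq: "b + a * MM m r = b + MM m t * (m t * (e * a))"
    by (simp add: e mult_ac)
  then show ?thesis
    using MM_pos[of m t, OF assms(2)] unfolding digit_def eq by simp
qed

lemma digit_add_high:
  assumes "b < MM m r"
  shows "digit m (b + a * MM m r) (r + t) = digit (\<lambda>t. m (r + t)) a t"
  using assms by (simp add: digit_def MM_add div_mult2_eq)

text \<open>The low digits come from \<open>b\<close>, the high ones from \<open>a\<close> read in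
  the radix system that starts at \<open>m r\<close>.\<close>

lemma chi_split:
  assumes "b < MM m r" "\<And>k. m k > 0"
  shows "chi (r + N) m u (b + a * MM m r) = chi r m u b * chi N (\<lambda>t. m (r + t)) (\<lambda>t. u (r + t)) a"
proof (induction N)
  case 0
  then show ?case using assms by (simp add: chi_def digit_add_low)
next
  case (Suc N)
  then show ?case
    using digit_add_high[OF assms(1), of a N] by (simp add: chi_def mult_ac)
qed

lemma sum_blocks:
  fixes f :: "nat \<Rightarrow> 'a :: comm_monoid_add"
  shows "(\<Sum>i<a * T + b. f i) = (\<Sum>d<a. \<Sum>e<T. f (e + d * T)) + (\<Sum>e<b. f (e + a * T))"
proof -
  have "(\<Sum>i<a * T + b. f i) = (\<Sum>i<a * T. f i) + (\<Sum>e<b. f (e + a * T))"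
    by (induction b) (simp_all add: add_ac)
  also have "(\<Sum>i<a * T. f i) = (\<Sum>d<a. \<Sum>e<T. f (e + d * T))"
  proof -
    have "(\<Sum>i<a * T. f i) = (\<Sum>d<a. \<Sum>i = d * T..<d * T + T. f i)"
      by (rule sum.nat_group[symmetric])
    also have "\<dots> = (\<Sum>d<a. \<Sum>e<T. f (e + d * T))"
    proof (rule sum.cong[OF refl])
      fix d
      show "(\<Sum>i = d * T..<d * T + T. f i) = (\<Sum>e<T. f (e + d * T))"
        using sum.shift_bounds_nat_ivl[of f 0 "d * T" T] by (simp add: lessThan_atLeast0 add.commute)
    qed
    finally show ?thesis .
  qed
  finally show ?thesis .
qed

context
  fixes m :: "nat \<Rightarrow> nat" and u :: "nat \<Rightarrow> complex"
  assumes m_pos: "\<And>k. m k > 0" and root: "\<And>t. u t ^ m t = 1"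
begin

lemma norm_u: "norm (u t) = 1"
  using root[of t] m_pos[of t] norm_power[of "u t" "m t"] power_eq_1_iff[of "norm (u t)" "m t"]
  by (metis norm_ge_zero norm_one order_less_irrefl power_eq_1_iff real_norm_def abs_norm_cancel)

lemma norm_chi: "norm (chi N m u n) = 1"
  by (simp add: chi_def norm_power norm_u flip: prod_norm)

text \<open>The digit at \<open>A\<close> runs through all residues while the lower digits stay
  fixed, which produces the full geometric sum of a nontrivial \<open>m A\<close>-th root of
  unity.\<close>

lemma sum_chi_period:
  assumes "u A \<noteq> 1" "A < N"
  shows "(\<Sum>i<MM m (Suc A). chi N m u i) = 0"
proof -
  have N: "chi N m u (e + d * MM m A) = chi A m u e * u A ^ d" if "e < MM m A" "d < m A" for d e
  proof -
    have "chi (A + (N - A)) m u (e + d * MM m A)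
        = chi A m u e * chi (N - A) (\<lambda>t. m (A + t)) (\<lambda>t. u (A + t)) d"
      using that m_pos by (intro chi_split)
    also have "chi (N - A) (\<lambda>t. m (A + t)) (\<lambda>t. u (A + t)) d = u A ^ d"
    proof -
      obtain k where k: "N - A = Suc k" using assms(2) by (metis Suc_diff_Suc)
      have "digit (\<lambda>t. m (A + t)) d (Suc i) = 0" for i
        using that(2) MM_add[of "\<lambda>t. m (A + t)" 1 i] by (simp add: digit_def div_mult2_eq)
      then show ?thesis
        using that(2) unfolding k chi_def by (subst prod.lessThan_Suc_shift) (simp add: digit_def)
    qed
    finally show ?thesis using assms(2) by simp
  qed
  have "(\<Sum>i<MM m (Suc A). chi N m u i) = (\<Sum>d<m A. \<Sum>e<MM m A. chi A m u e * u A ^ d)"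
    using sum_blocks[of "chi N m u" "m A" "MM m A" 0] by (simp add: N)
  also have "\<dots> = (\<Sum>e<MM m A. chi A m u e) * (\<Sum>d<m A. u A ^ d)"
    by (simp add: sum_product) (rule sum.swap)
  also have "(\<Sum>d<m A. u A ^ d) = 0"
    using assms root[of A] by (simp add: geometric_sum)
  finally show ?thesis by simp
qed

text \<open>All \<open>a\<close> complete blocks of length \<open>MM m (Suc A)\<close> cancel, and
  the incomplete one repeats the initial segment up to a factor depending only on
  \<open>a\<close>.\<close>

lemma sum_chi_block:
  assumes "u A \<noteq> 1" "A < N" "b < MM m (Suc A)"
  shows "(\<Sum>i<b + a * MM m (Suc A). chi N m u i)
    = chi (N - Suc A) (\<lambda>t. m (Suc A + t)) (\<lambda>t. u (Suc A + t)) a * (\<Sum>i<b. chi N m u i)"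
proof -
  let ?T = "MM m (Suc A)"
  let ?c = "chi (N - Suc A) (\<lambda>t. m (Suc A + t)) (\<lambda>t. u (Suc A + t))"
  have split: "chi N m u (e + d * ?T) = chi (Suc A) m u e * ?c d" if "e < ?T" for e d
    using chi_split[OF that m_pos, of "N - Suc A" u d] assms(2) by simp
  have chi0: "?c 0 = 1"
    by (simp add: chi_def digit_def)
  have eq: "chi N m u (e + d * ?T) = ?c d * chi N m u e" if "e < ?T" for e d
    using split[OF that, of d] split[OF that, of 0] chi0 by simp
  have "(\<Sum>i<b + a * ?T. chi N m u i) = (\<Sum>d<a. \<Sum>e<?T. chi N m u (e + d * ?T)) + (\<Sum>e<b. chi N m u (e + a * ?T))"
    by (subst add.commute) (rule sum_blocks)
  also have "(\<Sum>d<a. \<Sum>e<?T. chi N m u (e + d * ?T)) = (\<Sum>d<a. ?c d * (\<Sum>e<?T. chi N m u e))"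
    unfolding sum_distrib_left by (intro sum.cong refl eq) simp
  also have "\<dots> = 0"
    by (simp only: sum_chi_period[OF assms(1,2)] mult_zero_right sum.neutral_const)
  also have "(\<Sum>e<b. chi N m u (e + a * ?T)) = ?c a * (\<Sum>e<b. chi N m u e)"
    unfolding sum_distrib_left using assms(3) by (intro sum.cong refl eq) (simp del: MM.simps)
  finally show ?thesis by simp
qed

lemma norm_sum_chi_trivial: "norm (\<Sum>i<k. chi N m u i) \<le> k"
  using sum_norm_le[of "{..<k}" "chi N m u" "\<lambda>_. 1"] by (simp add: norm_chi)

end

text \<open>Up to a unimodular factor only the last incomplete block survives, and it has fewer than
  \<open>MM m (Suc A)\<close> terms.\<close>

lemma norm_sum_chi_le:
  assumes m: "\<And>k. m k > 0" and root: "\<And>t. u t ^ m t = 1" and A: "u A \<noteq> 1" "A < N"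
  shows "norm (\<Sum>i<k. chi N m u i) \<le> MM m (Suc A)"
proof -
  let ?T = "MM m (Suc A)"
  have T: "k mod ?T < ?T" using MM_pos[of m "Suc A", OF m] by simp
  have "norm (\<Sum>i<k mod ?T + k div ?T * ?T. chi N m u i) = norm (\<Sum>i<k mod ?T. chi N m u i)"
    using sum_chi_block[OF m root A T, of "k div ?T"] norm_chi[of "\<lambda>t. m (Suc A + t)" "\<lambda>t. u (Suc A + t)"] m root
    by (simp add: norm_mult)
  also have "\<dots> \<le> k mod ?T"
    by (rule norm_sum_chi_trivial[OF m root])
  also have "\<dots> \<le> ?T" using T by (simp del: MM.simps)
  finally show ?thesis by (simp only: mod_div_mult_eq)
qed

text \<open>Cancellation at \<open>s\<close> bounds every inner sum by \<open>?T\<close> and makes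
  blocks of length \<open>?T\<close> repeat up to factors \<open>?c d\<close>. These are characters
  of the shifted radix system, and cancellation at \<open>A\<close> bounds their sum by
  \<open>MM m (Suc A) / ?T\<close>. The factor 2 pays for the incomplete last block.\<close>

lemma norm_double_sum_chi_le:
  assumes m: "\<And>k. m k > 0" and root: "\<And>t. u t ^ m t = 1"
    and s: "u s \<noteq> 1" and A: "u A \<noteq> 1" "s < A" "A < N"
  shows "norm (\<Sum>k<j. \<Sum>i<k. chi N m u i) \<le> 2 * real (MM m (Suc s)) * real (MM m (Suc A))"
proof -
  let ?T = "MM m (Suc s)"
  define D where "D k = (\<Sum>i<k. chi N m u i)" for k
  let ?m' = "\<lambda>t. m (Suc s + t)" and ?u' = "\<lambda>t. u (Suc s + t)"
  let ?c = "chi (N - Suc s) ?m' ?u'"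
  have T: "j mod ?T < ?T" using MM_pos[of m "Suc s", OF m] by simp
  have sN: "s < N" using A by simp
  have D_le: "norm (D k) \<le> ?T" for k
    unfolding D_def by (rule norm_sum_chi_le[of m u s N, OF m root s sN])
  have block: "D (e + d * ?T) = ?c d * D e" if "e < ?T" for e d
    unfolding D_def by (rule sum_chi_block[OF m root s sN that])
  have MA: "MM m (Suc A) = ?T * MM ?m' (Suc (A - Suc s))"
    using MM_add[of m "Suc s" "A - s"] A(2) by (simp add: Suc_diff_Suc)
  have nc: "norm (?c a) = 1" for a
    by (rule norm_chi) (rule m root)+
  have c: "norm (\<Sum>d<a. ?c d) \<le> MM ?m' (Suc (A - Suc s))" for a
    using A by (intro norm_sum_chi_le) (auto simp: m root)
  \<comment> \<open>The function \<open>f\<close> covers both the plain sum over a full block and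
    the last block, multiplied by its factor.\<close>
  have sum_le: "norm (\<Sum>e<k. f (D e)) \<le> real ?T * real ?T"
    if "k \<le> ?T" "\<And>e. norm (f (D e)) \<le> ?T" for k and f :: "complex \<Rightarrow> complex"
  proof -
    have "norm (\<Sum>e<k. f (D e)) \<le> (\<Sum>e<k. real ?T)"
      using that by (intro sum_norm_le) auto
    also have "\<dots> \<le> real ?T * real ?T"
      using that by (simp del: MM.simps add: mult_right_mono)
    finally show ?thesis .
  qed
  have "(\<Sum>k<j. D k) = (\<Sum>d<j div ?T. \<Sum>e<?T. D (e + d * ?T)) + (\<Sum>e<j mod ?T. D (e + j div ?T * ?T))"
    using sum_blocks[of D "j div ?T" ?T "j mod ?T"] by (simp only: div_mult_mod_eq)
  also have "(\<Sum>d<j div ?T. \<Sum>e<?T. D (e + d * ?T)) = (\<Sum>d<j div ?T. ?c d) * (\<Sum>e<?T. D e)"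
    unfolding sum_product by (intro sum.cong refl block) simp
  also have "(\<Sum>e<j mod ?T. D (e + j div ?T * ?T)) = (\<Sum>e<j mod ?T. ?c (j div ?T) * D e)"
    using T by (intro sum.cong refl block) simp
  finally have "norm (\<Sum>k<j. D k) = norm ((\<Sum>d<j div ?T. ?c d) * (\<Sum>e<?T. D e)
      + (\<Sum>e<j mod ?T. ?c (j div ?T) * D e))"
    by (rule arg_cong)
  also have "\<dots>
      \<le> real (MM ?m' (Suc (A - Suc s))) * (real ?T * real ?T) + real ?T * real ?T"
  proof (intro order_trans[OF norm_triangle_ineq] add_mono)
    have "norm (\<Sum>e<?T. D e) \<le> real ?T * real ?T"
      using D_le by (intro sum_le[where f = "\<lambda>z. z"]) auto
    then show "norm ((\<Sum>d<j div ?T. ?c d) * (\<Sum>e<?T. D e))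
        \<le> real (MM ?m' (Suc (A - Suc s))) * (real ?T * real ?T)"
      unfolding norm_mult by (intro mult_mono c) auto
    show "norm (\<Sum>e<j mod ?T. ?c (j div ?T) * D e) \<le> real ?T * real ?T"
    proof (rule sum_le[where f = "\<lambda>z. _ * z"])
      show "norm (?c (j div ?T) * D e) \<le> ?T" for e
        unfolding norm_mult nc mult_1 by (rule D_le)
    qed (rule less_imp_le[OF T])
  qed
  also have "\<dots> \<le> real (MM ?m' (Suc (A - Suc s))) * (real ?T * real ?T)
      + real (MM ?m' (Suc (A - Suc s))) * (real ?T * real ?T)"
  proof -
    have "1 \<le> real (MM ?m' (Suc (A - Suc s)))"
      using MM_pos[of ?m' "Suc (A - Suc s)"] m by (simp only: real_of_nat_ge_one_iff Suc_le_eq One_nat_def)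
    from mult_right_mono[OF this, of "real ?T * real ?T"]
    show ?thesis by (simp only: mult_1 add_left_mono zero_le_mult_iff of_nat_0_le_iff simp_thms)
  qed
  also have "\<dots> = 2 * real ?T * real (MM m (Suc A))"
    unfolding MA by (simp only: of_nat_mult) algebra
  finally show ?thesis by (simp add: D_def)
qed

section \<open>Integration of functions of finitely many coordinates\<close>

locale vilenkin =
  fixes m :: "nat \<Rightarrow> nat" and \<mu> :: "(nat \<Rightarrow> nat) measure" and R :: nat
  assumes m_ge: "\<And>k. 2 \<le> m k" and m_le: "\<And>k. m k \<le> R" and haar: "normalized_haar m \<mu>"
begin

abbreviation M :: "nat \<Rightarrow> nat" where "M \<equiv> MM m"

lemma m_pos: "0 < m k"
  using m_ge[of k] by linarith

lemma M_pos: "0 < M k"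
  by (rule MM_pos[OF m_pos])

lemma M_double: "2 * real (M k) \<le> real (M (Suc k))"
  using m_ge[of k] by (simp add: mult_right_mono)

lemma M_Suc_le: "real (M (Suc k)) \<le> R * real (M k)"
  using m_le[of k] by (simp add: mult_right_mono)

lemma M_mono: "a \<le> b \<Longrightarrow> M a \<le> M b"
  by (rule dvd_imp_le[OF MM_dvd M_pos])

lemma le_M: "N \<le> M N"
proof (induction N)
  case (Suc N)
  have "2 * M N \<le> M (Suc N)" using m_ge[of N] by simp
  then show ?case using Suc M_pos[of N] by linarith
qed simp

lemma M_prod: "M N = (\<Prod>k<N. m k)"
  by (induction N) (simp_all add: mult.commute)

lemma Gm_iff: "x \<in> Gm m \<longleftrightarrow> (\<forall>k. x k < m k)"
  by (auto simp: Gm_def PiE_iff)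

text \<open>Representatives of the cells of level \<open>N\<close>.\<close>

definition pts :: "nat \<Rightarrow> (nat \<Rightarrow> nat) set" where
  "pts N = PiE_dflt {..<N} 0 (\<lambda>k. {..<m k})"

lemma finite_pts [simp]: "finite (pts N)"
  unfolding pts_def by (rule finite_PiE_dflt) auto

lemma pts_Gm: "x \<in> Gm m" if "x \<in> pts N"
  unfolding Gm_iff
proof
  show "x k < m k" for k
    using that m_pos[of k] by (cases "k < N") (auto simp: pts_def PiE_dflt_def)
qed

lemma card_pts: "card (pts N) = M N"
  by (simp add: pts_def card_PiE_dflt M_prod)

lemma pts_eqI: "x \<in> pts N \<Longrightarrow> y \<in> pts N \<Longrightarrow> (\<And>k. k < N \<Longrightarrow> x k = y k) \<Longrightarrow> x = y"
  by (rule ext) (auto simp: pts_def PiE_dflt_def, metis)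

lemma ex_pts: "x \<in> Gm m \<Longrightarrow> \<exists>y\<in>pts N. \<forall>k<N. x k = y k"
  by (intro bexI[of _ "\<lambda>k. if k < N then x k else 0"]) (auto simp: pts_def PiE_dflt_def Gm_iff)

lemma card_pts_agree:
  assumes "y \<in> Gm m" "D \<subseteq> {..<N}"
  shows "card {x \<in> pts N. \<forall>i\<in>D. x i = y i} * (\<Prod>i\<in>D. m i) = M N"
proof -
  have "{x \<in> pts N. \<forall>i\<in>D. x i = y i} = PiE_dflt {..<N} 0 (\<lambda>i. if i \<in> D then {y i} else {..<m i})"
    using assms by (auto simp: pts_def PiE_dflt_def Gm_iff split: if_splits) metis
  then have "card {x \<in> pts N. \<forall>i\<in>D. x i = y i} = (\<Prod>i<N. if i \<in> D then 1 else m i)"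
    by (simp add: card_PiE_dflt if_distrib cong: if_cong)
  also have "\<dots> = (\<Prod>i\<in>{..<N} - D. m i)"
    by (rule prod.mono_neutral_cong_right) auto
  finally show ?thesis
    using assms by (simp add: M_prod prod.subset_diff[of D])
qed

lemma card_pts_cell:
  assumes "y \<in> Gm m" "n \<le> N"
  shows "card {x \<in> pts N. \<forall>i<n. x i = y i} * M n = M N"
  using card_pts_agree[OF assms(1), of "{..<n}" N] assms(2) by (simp add: M_prod Ball_def)

text \<open>Freeing the coordinate \<open>s < n\<close> enlarges a cell by the factor
  \<open>m s\<close>, at most \<open>R\<close>; for \<open>s \<ge> n\<close> nothing is
  freed.\<close>

lemma card_pts_cell_except:
  assumes "y \<in> Gm m" "n \<le> N"
  shows "card {x \<in> pts N. \<forall>i<n. i \<noteq> s \<longrightarrow> x i = y i} * M n \<le> R * M N"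
proof -
  let ?c = "card {x \<in> pts N. \<forall>i<n. i \<noteq> s \<longrightarrow> x i = y i}"
  have *: "?c * (\<Prod>i\<in>{..<n} - {s}. m i) = M N"
    using card_pts_agree[OF assms(1), of "{..<n} - {s}" N] assms(2)
    by (simp add: Ball_def imp_conjL subset_iff)
  have "M n \<le> R * (\<Prod>i\<in>{..<n} - {s}. m i)"
  proof (cases "s < n")
    case True
    then have "M n = m s * (\<Prod>i\<in>{..<n} - {s}. m i)"
      by (simp add: M_prod prod.remove)
    then show ?thesis using m_le[of s] by simp
  next
    case False
    then have "M n = (\<Prod>i\<in>{..<n} - {s}. m i)" by (simp add: M_prod)
    then show ?thesis using m_le[of 0] m_ge[of 0] by simp
  qed
  then have "?c * M n \<le> ?c * (R * (\<Prod>i\<in>{..<n} - {s}. m i))" by simp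
  also have "\<dots> = R * M N" unfolding *[symmetric] by simp
  finally show ?thesis .
qed

section \<open>Haar measure of cells and integrals of functions constant on them\<close>

lemma space_mu: "space \<mu> = Gm m"
  using haar by (simp add: normalized_haar_def)

lemma cell_sets: "cell m N x \<in> sets \<mu>" if x: "x \<in> Gm m"
proof -
  have eq: "cell m N x = (\<Pi>\<^sub>E k\<in>UNIV. if k < N then {x k} else {..<m k})"
    using x by (auto simp: cell_def Gm_iff PiE_iff split: if_splits)
  have "openin (Gm_topology m) (cell m N x)"
    unfolding Gm_topology_def eq openin_PiE_gen using x
    by (auto simp: Gm_iff intro: finite_subset[of _ "{..<N}"])
  then show ?thesis
    using haar by (simp add: normalized_haar_def sigma_sets.Basic)
qed

text \<open>Translation by \<open>x\<close> carries the cell of the identity onto the cell of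
  \<open>x\<close>, and Haar measure is translation invariant.\<close>

lemma emeasure_cell_eq:
  assumes x: "x \<in> Gm m"
  shows "emeasure \<mu> (cell m N x) = emeasure \<mu> (cell m N (\<lambda>_. 0))"
proof -
  have z: "(\<lambda>_. 0) \<in> Gm m" using m_pos by (simp add: Gm_iff)
  have "Gm_add m x ` cell m N (\<lambda>_. 0) = cell m N x"
  proof (intro equalityI subsetI)
    fix y assume "y \<in> Gm_add m x ` cell m N (\<lambda>_. 0)"
    then show "y \<in> cell m N x"
      using x m_pos by (auto simp: cell_def Gm_add_def Gm_iff)
  next
    fix y assume y: "y \<in> cell m N x"
    \<comment> \<open>The group difference of \<open>y\<close> and \<open>x\<close>, written with
      \<open>m k - x k\<close> so that subtraction of naturals never truncates.\<close>
    define z where "z = (\<lambda>k. (y k + (m k - x k)) mod m k)"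
    have "(x k + z k) mod m k = y k" for k
    proof -
      have "x k < m k" "y k < m k" using x y by (auto simp: Gm_iff cell_def)
      then show ?thesis by (simp add: z_def mod_add_right_eq)
    qed
    then have "Gm_add m x z = y" by (simp add: Gm_add_def)
    moreover have "z k = 0" if "k < N" for k
    proof -
      have "x k < m k" "y k = x k" using x y that by (auto simp: Gm_iff cell_def)
      then show ?thesis by (simp add: z_def)
    qed
    then have "z \<in> cell m N (\<lambda>_. 0)"
      using m_pos by (auto simp: cell_def Gm_iff z_def)
    ultimately show "y \<in> Gm_add m x ` cell m N (\<lambda>_. 0)" by blast
  qed
  then show ?thesis
    using haar[unfolded normalized_haar_def] x cell_sets[OF z, of N] by force
qed

lemma disjoint_cells: "disjoint_family_on (cell m N) (pts N)"
  unfolding disjoint_family_on_def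
proof (intro ballI impI)
  fix a b assume "a \<in> pts N" "b \<in> pts N" "a \<noteq> b"
  then show "cell m N a \<inter> cell m N b = {}"
    using pts_eqI[of a N b] by (force simp: cell_def)
qed

lemma Union_cells: "(\<Union>c\<in>pts N. cell m N c) = Gm m"
  using ex_pts[of _ N] by (force simp: cell_def)

text \<open>The \<open>M N\<close> cells of level \<open>N\<close> partition the group and have
  equal measure.\<close>

lemma emeasure_cell:
  assumes x: "x \<in> Gm m"
  shows "emeasure \<mu> (cell m N x) = ennreal (1 / M N)"
proof -
  let ?e = "emeasure \<mu> (cell m N (\<lambda>_. 0))"
  have "1 = emeasure \<mu> (\<Union>c\<in>pts N. cell m N c)"
    using haar by (simp add: Union_cells normalized_haar_def)
  also have "\<dots> = (\<Sum>c\<in>pts N. emeasure \<mu> (cell m N c))"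
    using disjoint_cells cell_sets pts_Gm by (intro sum_emeasure[symmetric]) auto
  also have "\<dots> = of_nat (M N) * ?e"
    using emeasure_cell_eq pts_Gm by (simp add: card_pts)
  finally have e: "1 = of_nat (M N) * ?e" .
  have "?e = ?e * of_nat (M N) / of_nat (M N)"
    using M_pos[of N] by (intro ennreal_mult_divide_eq[symmetric]) auto
  also have "?e * of_nat (M N) = 1" using e by (simp add: mult.commute)
  also have "1 / of_nat (M N) = ennreal (1 / M N)"
    using M_pos[of N] divide_ennreal[of 1 "real (M N)"] by (simp add: ennreal_of_nat_eq_real_of_nat)
  finally show ?thesis using emeasure_cell_eq[OF x] by simp
qed

text \<open>A pointwise substitute for measurability at level \<open>N\<close>; under it integrals
  are finite averages over \<open>pts N\<close>.\<close>

definition level :: "nat \<Rightarrow> ((nat \<Rightarrow> nat) \<Rightarrow> 'a) \<Rightarrow> bool" where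
  "level N h \<longleftrightarrow> (\<forall>x\<in>Gm m. \<forall>y\<in>Gm m. (\<forall>k<N. x k = y k) \<longrightarrow> h x = h y)"

lemma levelD: "level N h \<Longrightarrow> x \<in> Gm m \<Longrightarrow> y \<in> Gm m \<Longrightarrow> (\<And>k. k < N \<Longrightarrow> x k = y k) \<Longrightarrow> h x = h y"
  unfolding level_def by blast

lemma level_mono: "level n h \<Longrightarrow> n \<le> N \<Longrightarrow> level N h"
  unfolding level_def by (meson less_le_trans)

lemma level_indicator_sum:
  assumes "level N h" "x \<in> Gm m"
  obtains c where "c \<in> pts N" "h x = h c" "\<And>d. d \<in> pts N \<Longrightarrow> x \<in> cell m N d \<longleftrightarrow> d = c"
proof -
  obtain c where c: "c \<in> pts N" "\<forall>k<N. x k = c k" using ex_pts[OF assms(2)] by blast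
  show ?thesis
  proof
    show "h x = h c" using c by (intro levelD[OF assms pts_Gm]) auto
    show "x \<in> cell m N d \<longleftrightarrow> d = c" if "d \<in> pts N" for d
      using c that assms(2) pts_eqI[of d N c] by (auto simp: cell_def)
  qed (rule c)
qed

lemma nn_integral_level:
  fixes h :: "_ \<Rightarrow> ennreal"
  assumes "level N h"
  shows "(\<integral>\<^sup>+x. h x \<partial>\<mu>) = (\<Sum>c\<in>pts N. h c * ennreal (1 / M N))"
proof -
  have "(\<integral>\<^sup>+x. h x \<partial>\<mu>) = (\<integral>\<^sup>+x. (\<Sum>c\<in>pts N. h c * indicator (cell m N c) x) \<partial>\<mu>)"
  proof (intro nn_integral_cong)
    fix x assume "x \<in> space \<mu>"
    then obtain c where c: "c \<in> pts N" "h x = h c" "\<And>d. d \<in> pts N \<Longrightarrow> x \<in> cell m N d \<longleftrightarrow> d = c"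
      using level_indicator_sum[OF assms] by (metis space_mu)
    have "(\<Sum>d\<in>pts N. h d * indicator (cell m N d) x) = (\<Sum>d\<in>pts N. if d = c then h c else 0)"
      using c by (intro sum.cong) (auto simp: indicator_def)
    then show "h x = (\<Sum>d\<in>pts N. h d * indicator (cell m N d) x)"
      using c by simp
  qed
  also have "\<dots> = (\<Sum>c\<in>pts N. h c * emeasure \<mu> (cell m N c))"
    using cell_sets pts_Gm by (subst nn_integral_sum) (auto simp: nn_integral_cmult_indicator)
  finally show ?thesis
    using emeasure_cell pts_Gm by simp
qed

lemma integral_level:
  fixes h :: "_ \<Rightarrow> complex"
  assumes "level N h"
  shows "(LINT x|\<mu>. h x) = (\<Sum>c\<in>pts N. h c) / M N"
proof -
  have "(LINT x|\<mu>. h x) = (LINT x|\<mu>. (\<Sum>c\<in>pts N. indicator (cell m N c) x *\<^sub>R h c))"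
  proof (intro Bochner_Integration.integral_cong refl)
    fix x assume "x \<in> space \<mu>"
    then obtain c where c: "c \<in> pts N" "h x = h c" "\<And>d. d \<in> pts N \<Longrightarrow> x \<in> cell m N d \<longleftrightarrow> d = c"
      using level_indicator_sum[OF assms] by (metis space_mu)
    have "(\<Sum>d\<in>pts N. indicator (cell m N d) x *\<^sub>R h d) = (\<Sum>d\<in>pts N. if d = c then h c else 0)"
      using c by (intro sum.cong) (auto simp: indicator_def)
    then show "h x = (\<Sum>d\<in>pts N. indicator (cell m N d) x *\<^sub>R h d)"
      using c by simp
  qed
  also have "\<dots> = (\<Sum>c\<in>pts N. measure \<mu> (cell m N c) *\<^sub>R h c)"
    using cell_sets pts_Gm emeasure_cell
    by (subst Bochner_Integration.integral_sum)
      (auto intro!: integrable_real_indicator sum.cong simp: sets.sets_into_space Int_absorb2)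
  also have "\<dots> = (\<Sum>c\<in>pts N. h c) / M N"
    using emeasure_cell pts_Gm by (simp add: measure_def sum_divide_distrib scaleR_conv_of_real)
  finally show ?thesis .
qed

section \<open>Vilenkin functions and Dirichlet kernels\<close>

lemma digit_high: "i < M N \<Longrightarrow> N \<le> t \<Longrightarrow> digit m i t = 0"
  using M_mono[of N t] by (simp add: digit_def)

lemma psi_eq_chi:
  assumes "i < M N"
  shows "psi m i x = chi N m (\<lambda>t. rademacher m t x) i"
  unfolding psi_def chi_def using assms digit_high
  by (intro prodinf_finite) auto

lemma rademacher_cis: "rademacher m t x = cis (2 * pi * real (x t) / real (m t))"
  by (simp add: rademacher_def cis_conv_exp mult_ac)

text \<open>The \<open>t\<close>-th Rademacher function at the group difference of \<open>x\<close>
  and \<open>y\<close>; the product form avoids subtraction in the group.\<close>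

definition ratio :: "(nat \<Rightarrow> nat) \<Rightarrow> (nat \<Rightarrow> nat) \<Rightarrow> nat \<Rightarrow> complex" where
  "ratio x y t = rademacher m t x * cnj (rademacher m t y)"

lemma ratio_root: "x \<in> Gm m \<Longrightarrow> y \<in> Gm m \<Longrightarrow> ratio x y t ^ m t = 1"
proof -
  have *: "rademacher m t z ^ m t = 1" for z
    using m_pos[of t] by (simp add: rademacher_cis Complex.DeMoivre cis_multiple_2pi)
  show "ratio x y t ^ m t = 1"
    by (simp only: ratio_def power_mult_distrib complex_cnj_power[symmetric] *) simp
qed

lemma ratio_eq_1_iff:
  assumes "x \<in> Gm m" "y \<in> Gm m"
  shows "ratio x y t = 1 \<longleftrightarrow> x t = y t"
proof -
  have inj: "inj_on (\<lambda>k. cis (2 * pi * real k / real (m t))) {..<m t}"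
    using Complex.bij_betw_roots_unity[OF m_pos[of t]] by (simp add: bij_betw_def)
  have "ratio x y t = 1 \<longleftrightarrow> rademacher m t x = rademacher m t y"
    by (simp add: ratio_def rademacher_cis cis_cnj field_simps flip: cis_inverse)
  also have "\<dots> \<longleftrightarrow> x t = y t"
    using inj_on_eq_iff[OF inj, of "x t" "y t"] assms by (simp add: rademacher_cis Gm_iff)
  finally show ?thesis .
qed

lemma psi_mult_cnj:
  assumes "i < M N"
  shows "psi m i x * cnj (psi m i y) = chi N m (ratio x y) i"
  by (simp add: psi_eq_chi[OF assms] chi_def ratio_def power_mult_distrib prod.distrib)

lemma level_psi: "i < M N \<Longrightarrow> level N (psi m i)"
  by (auto simp: level_def psi_eq_chi chi_def rademacher_def)

lemma level_mult_cnj: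
  fixes g h :: "_ \<Rightarrow> complex"
  assumes "level N g" "level N h"
  shows "level N (\<lambda>x. g x * cnj (h x))"
  unfolding level_def
proof (intro ballI impI)
  fix x y assume "x \<in> Gm m" "y \<in> Gm m" "\<forall>k<N. x k = y k"
  then show "g x * cnj (h x) = g y * cnj (h y)"
    using levelD[OF assms(1), of x y] levelD[OF assms(2), of x y] by simp
qed

text \<open>Convolution with the Dirichlet kernel: the inner sum over \<open>i < k\<close> is its
  value at the group difference of \<open>x\<close> and \<open>y\<close>.\<close>

lemma partial_sum_level:
  assumes "level N g" "k \<le> M N"
  shows "partial_sum m \<mu> k g x = (\<Sum>y\<in>pts N. g y * (\<Sum>i<k. chi N m (ratio x y) i)) / M N"
proof -
  have "fourier_coeff m \<mu> g i = (\<Sum>y\<in>pts N. g y * cnj (psi m i y)) / M N" if "i < k" for i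
  proof -
    have "level N (psi m i)" using assms that by (intro level_psi) simp
    then show ?thesis
      unfolding fourier_coeff_def by (rule integral_level[OF level_mult_cnj[OF assms(1)]])
  qed
  then have "partial_sum m \<mu> k g x = (\<Sum>i<k. (\<Sum>y\<in>pts N. g y * cnj (psi m i y)) / M N * psi m i x)"
    by (simp add: partial_sum_def)
  also have "\<dots> = (\<Sum>i<k. (\<Sum>y\<in>pts N. g y * (psi m i x * cnj (psi m i y))) / M N)"
    by (simp add: sum_distrib_left mult_ac)
  also have "\<dots> = (\<Sum>i<k. (\<Sum>y\<in>pts N. g y * chi N m (ratio x y) i)) / M N"
    using assms(2) by (simp add: psi_mult_cnj[of _ N] sum_divide_distrib[symmetric])
  finally show ?thesis
    by (subst (asm) sum.swap) (simp add: sum_distrib_left)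
qed

text \<open>If a coordinate \<open>t < n\<close> differs, the range \<open>i < M n\<close> consists
  of complete blocks of length \<open>M (Suc t)\<close>, each summing to zero; otherwise every term
  is 1.\<close>

lemma sum_chi_ratio:
  assumes "x \<in> Gm m" "y \<in> Gm m" "n \<le> N"
  shows "(\<Sum>i<M n. chi N m (ratio x y) i) = (if \<forall>t<n. x t = y t then of_nat (M n) else 0)"
proof (cases "\<forall>t<n. x t = y t")
  case True
  have "chi N m (ratio x y) i = 1" if "i < M n" for i
    unfolding chi_def
  proof (rule prod.neutral, intro ballI)
    fix t
    show "ratio x y t ^ digit m i t = 1"
      using True that digit_high[of i n t] ratio_eq_1_iff[OF assms(1,2), of t] by (cases "t < n") auto
  qed
  then show ?thesis using True by simp
next
  case False
  then obtain t where t: "t < n" "x t \<noteq> y t" by blast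
  then have u: "ratio x y t \<noteq> 1" using ratio_eq_1_iff[OF assms(1,2)] by simp
  have "M (Suc t) dvd M n" using t by (intro MM_dvd) simp
  then obtain e where e: "M n = M (Suc t) * e" by (rule dvdE)
  have "(\<Sum>i<0 + e * M (Suc t). chi N m (ratio x y) i) = 0"
    using t assms M_pos[of "Suc t"]
    by (subst sum_chi_block[where A = t]) (auto simp: m_pos ratio_root u simp del: MM.simps)
  then show ?thesis using False by (auto simp: e mult.commute simp del: MM.simps)
qed

section \<open>Fourier coefficients and partial sums of martingales\<close>

lemma level_martingale:
  assumes "is_martingale m \<mu> f"
  shows "level n (f n)"
  unfolding level_def
proof (intro ballI impI)
  fix x y assume xy: "x \<in> Gm m" "y \<in> Gm m" "\<forall>k<n. x k = y k"
  \<comment> \<open>The martingale identity for \<open>k = n\<close> makes \<open>f n\<close> a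
    combination of functions \<open>psi m i\<close> with \<open>i < M n\<close>, which depend on the
    first \<open>n\<close> coordinates only.\<close>
  have "f n z = (\<Sum>i<M n. fourier_coeff m \<mu> (f n) i * psi m i z)" if "z \<in> Gm m" for z
    using assms that by (simp add: is_martingale_def partial_sum_def)
  then show "f n x = f n y"
    using xy levelD[OF level_psi, of _ n x y] by simp
qed

text \<open>\<open>f n\<close> averages \<open>f k\<close> over the cells of level \<open>n\<close>,
  and \<open>psi m i\<close> with \<open>i < M n\<close> is constant there, so averaging does not
  change the coefficient.\<close>

lemma fourier_coeff_martingale:
  assumes f: "is_martingale m \<mu> f" and "n \<le> k" "i < M n"
  shows "fourier_coeff m \<mu> (f n) i = fourier_coeff m \<mu> (f k) i"
proof -
  have fk: "level k (f k)" and fn: "level k (f n)"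
    using level_martingale[OF f, of k] level_mono[OF level_martingale[OF f, of n] \<open>n \<le> k\<close>] by auto
  have i: "i < M k" using assms(3) M_mono[OF assms(2)] by simp
  have lev: "level k (\<lambda>y. g y * cnj (psi m i y))" if "level k g" for g
    using that level_psi[OF i] by (rule level_mult_cnj)
  let ?cell = "\<lambda>y. {x \<in> pts k. \<forall>t<n. x t = y t}"
  have fn_eq: "f n x = (\<Sum>y\<in>pts k. if \<forall>t<n. x t = y t then f k y * of_nat (M n) else 0) / M k"
    if x: "x \<in> pts k" for x
  proof -
    have "f n x = partial_sum m \<mu> (M n) (f k) x"
      using f assms(2) pts_Gm[OF x] by (simp add: is_martingale_def)
    also have "\<dots> = (\<Sum>y\<in>pts k. f k y * (\<Sum>i<M n. chi k m (ratio x y) i)) / M k"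
      using fk M_mono[OF assms(2)] by (rule partial_sum_level)
    also have "(\<Sum>y\<in>pts k. f k y * (\<Sum>i<M n. chi k m (ratio x y) i))
        = (\<Sum>y\<in>pts k. if \<forall>t<n. x t = y t then f k y * of_nat (M n) else 0)"
      using x assms(2) by (intro sum.cong refl) (auto simp: sum_chi_ratio pts_Gm)
    finally show ?thesis .
  qed
  have "fourier_coeff m \<mu> (f n) i = (\<Sum>x\<in>pts k. f n x * cnj (psi m i x)) / M k"
    unfolding fourier_coeff_def by (rule integral_level[OF lev[OF fn]])
  also have "(\<Sum>x\<in>pts k. f n x * cnj (psi m i x))
      = (\<Sum>x\<in>pts k. \<Sum>y\<in>pts k. if \<forall>t<n. x t = y t then f k y * cnj (psi m i y) * (M n / M k) else 0)"
  proof (rule sum.cong[OF refl])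
    fix x assume x: "x \<in> pts k"
    have psi: "psi m i x = psi m i y" if "y \<in> pts k" "\<forall>t<n. x t = y t" for y
      using that x by (intro levelD[OF level_psi[OF assms(3)] pts_Gm pts_Gm]) auto
    show "f n x * cnj (psi m i x)
        = (\<Sum>y\<in>pts k. if \<forall>t<n. x t = y t then f k y * cnj (psi m i y) * (M n / M k) else 0)"
      unfolding fn_eq[OF x] sum_divide_distrib sum_distrib_right
      using psi by (intro sum.cong refl) auto
  qed
  \<comment> \<open>With the sum over \<open>x\<close> innermost, each \<open>y\<close> is counted
    once for every point of its cell of level \<open>n\<close>; there are \<open>M k / M n\<close>
    of them.\<close>
  also have "\<dots> = (\<Sum>y\<in>pts k. \<Sum>x\<in>?cell y. f k y * cnj (psi m i y) * (M n / M k))"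
    by (subst sum.swap) (simp only: sum.inter_filter[OF finite_pts])
  also have "\<dots> = (\<Sum>y\<in>pts k. f k y * cnj (psi m i y))"
  proof (rule sum.cong[OF refl])
    fix y assume y: "y \<in> pts k"
    have "of_nat (card (?cell y) * M n) = (of_nat (M k) :: complex)"
      using card_pts_cell[OF pts_Gm[OF y] assms(2)] by simp
    then have one: "of_nat (card (?cell y)) * (of_nat (M n) / of_nat (M k)) = (1 :: complex)"
      using M_pos[of k] by simp
    have "(\<Sum>x\<in>?cell y. f k y * cnj (psi m i y) * (M n / M k))
        = f k y * cnj (psi m i y) * (of_nat (card (?cell y)) * (of_nat (M n) / of_nat (M k)))"
      by simp
    then show "(\<Sum>x\<in>?cell y. f k y * cnj (psi m i y) * (M n / M k)) = f k y * cnj (psi m i y)"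
      by (simp only: one mult_1_right)
  qed
  also have "(\<Sum>y\<in>pts k. f k y * cnj (psi m i y)) / M k = fourier_coeff m \<mu> (f k) i"
    unfolding fourier_coeff_def by (rule integral_level[OF lev[OF fk], symmetric])
  finally show ?thesis .
qed

text \<open>The coefficients of index below \<open>M L\<close> are constant along the martingale
  from \<open>L\<close> on, so the limit in \<open>mart_coeff\<close> is the coefficient of
  \<open>f L\<close>.\<close>

lemma mart_partial_sum_eq:
  assumes f: "is_martingale m \<mu> f" and "k \<le> M L"
  shows "mart_partial_sum m \<mu> k f x = partial_sum m \<mu> k (f L) x"
proof -
  have "mart_coeff m \<mu> f i = fourier_coeff m \<mu> (f L) i" if "i < k" for i
  proof -
    have "\<forall>\<^sub>F n in sequentially. fourier_coeff m \<mu> (f n) i = fourier_coeff m \<mu> (f L) i"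
      using fourier_coeff_martingale[OF f] assms(2) that
      by (intro eventually_sequentiallyI[of L]) (metis less_le_trans)
    then have "(\<lambda>n. fourier_coeff m \<mu> (f n) i) \<longlonglongrightarrow> fourier_coeff m \<mu> (f L) i"
      by (rule tendsto_eventually)
    then show ?thesis
      unfolding mart_coeff_def fourier_coeff_def[symmetric] by (rule limI)
  qed
  then show ?thesis
    by (simp add: mart_partial_sum_def partial_sum_def)
qed

end

section \<open>Fejer kernels and Noerlund means\<close>

lemma sum_mult_double_sum:
  fixes h :: "'a \<Rightarrow> 'd :: comm_semiring_0"
  shows "(\<Sum>y\<in>Y. h y * (\<Sum>i\<in>I. \<Sum>j\<in>J i. K i j * b i j y)) = (\<Sum>i\<in>I. \<Sum>j\<in>J i. K i j * (\<Sum>y\<in>Y. h y * b i j y))"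
proof -
  have "(\<Sum>y\<in>Y. h y * (\<Sum>i\<in>I. \<Sum>j\<in>J i. K i j * b i j y))
      = (\<Sum>i\<in>I. \<Sum>y\<in>Y. \<Sum>j\<in>J i. h y * (K i j * b i j y))"
    unfolding sum_distrib_left by (rule sum.swap)
  also have "\<dots> = (\<Sum>i\<in>I. \<Sum>j\<in>J i. \<Sum>y\<in>Y. h y * (K i j * b i j y))"
    by (rule sum.cong[OF refl sum.swap])
  finally show ?thesis by (simp add: sum_distrib_left mult.left_commute)
qed

context vilenkin begin

lemma R_ge: "1 \<le> real R"
  using m_le[of 0] m_ge[of 0] by linarith

text \<open>The bound depends on how many coordinates below \<open>L\<close> distinguish
  \<open>x\<close> from \<open>y\<close>: none leaves the trivial estimate, one gives a single
  cancellation, two or more give the double cancellation of \<open>norm_double_sum_chi_le\<close>.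
  In each case one term of the double sum on the right suffices.\<close>

lemma norm_fejer_kernel_le:
  assumes xy: "x \<in> Gm m" "y \<in> Gm m" and L: "L \<le> N" "j \<le> M L"
  shows "norm (\<Sum>k=1..j. \<Sum>i<k. chi N m (ratio x y) i)
    \<le> 2 * real R ^ 2 * (\<Sum>A\<le>L. \<Sum>s\<le>A. real (M s) * real (M A) * of_bool (\<forall>i<A. i \<noteq> s \<longrightarrow> y i = x i))"
    (is "?F \<le> _ * ?W")
proof -
  let ?D = "\<lambda>k. \<Sum>i<k. chi N m (ratio x y) i"
  have root: "ratio x y t ^ m t = 1" for t by (rule ratio_root[OF xy])
  have W: "real (M s) * real (M A) \<le> ?W" if "s \<le> A" "A \<le> L" "\<forall>i<A. i \<noteq> s \<longrightarrow> y i = x i" for s A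
  proof -
    have "real (M s) * real (M A) = real (M s) * real (M A) * of_bool (\<forall>i<A. i \<noteq> s \<longrightarrow> y i = x i)"
      using that(3) by simp
    also have "\<dots> \<le> (\<Sum>s\<le>A. real (M s) * real (M A) * of_bool (\<forall>i<A. i \<noteq> s \<longrightarrow> y i = x i))"
      using that(1) by (intro member_le_sum[where i = s]) auto
    also have "\<dots> \<le> ?W"
      using that(2) by (intro member_le_sum[where i = A]) (auto intro!: sum_nonneg)
    finally show ?thesis .
  qed
  have W0: "0 \<le> ?W" by (intro sum_nonneg) auto
  have R2: "1 \<le> real R ^ 2" "real R \<le> real R ^ 2"
    using one_le_power[OF R_ge, of 2] self_le_power[OF R_ge, of 2] by simp_all
  have sum_le: "?F \<le> j * B" if "\<And>k. k \<le> j \<Longrightarrow> norm (?D k) \<le> B" for B :: real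
    using sum_norm_le[of "{1..j}" ?D "\<lambda>_. B"] that by simp
  show ?thesis
  proof (cases "\<exists>t<L. x t \<noteq> y t")
    case False
    \<comment> \<open>No difference below \<open>L\<close>: the term with \<open>s = A = L\<close>
      is used.\<close>
    have "?F \<le> j * real j"
      by (intro sum_le order_trans[OF norm_sum_chi_trivial[of m "ratio x y", OF m_pos root]]) simp
    also have "\<dots> \<le> real (M L) * real (M L)"
      using L by (intro mult_mono) auto
    also have "\<dots> \<le> 1 * ?W"
      using W[of L L] False by simp
    also have "\<dots> \<le> 2 * real R ^ 2 * ?W"
      using W0 R2 by (intro mult_right_mono) auto
    finally show ?thesis .
  next
    case True
    define s where "s = (LEAST t. t < L \<and> x t \<noteq> y t)"
    have s: "s < L" "x s \<noteq> y s"
      using LeastI_ex[of "\<lambda>t. t < L \<and> x t \<noteq> y t"] True by (auto simp: s_def)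
    have s_least: "x i = y i" if "i < s" for i
      using not_less_Least[of i "\<lambda>t. t < L \<and> x t \<noteq> y t"] that s by (auto simp: s_def)
    have us: "ratio x y s \<noteq> 1" using s ratio_eq_1_iff[OF xy] by simp
    show ?thesis
    proof (cases "\<exists>t>s. t < L \<and> x t \<noteq> y t")
      case False
      \<comment> \<open>Exactly one difference below \<open>L\<close>: the term with this
        \<open>s\<close> and \<open>A = L\<close> is used.\<close>
      have eq: "\<forall>i<L. i \<noteq> s \<longrightarrow> y i = x i"
        using False s_least by (metis linorder_neqE_nat)
      have "?F \<le> j * real (M (Suc s))"
        using s L by (intro sum_le norm_sum_chi_le[of m "ratio x y", OF m_pos root us]) auto
      also have "\<dots> \<le> real (M L) * (R * real (M s))"
        using L by (intro mult_mono M_Suc_le) auto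
      also have "\<dots> = R * (real (M s) * real (M L))" by simp
      also have "\<dots> \<le> (2 * real R ^ 2) * ?W"
      proof (rule mult_mono)
        show "real R \<le> 2 * real R ^ 2" using R2 by linarith
        show "real (M s) * real (M L) \<le> ?W" using eq s by (intro W) auto
      qed auto
      finally show ?thesis .
    next
      case True
      define A where "A = (LEAST t. s < t \<and> t < L \<and> x t \<noteq> y t)"
      have A: "s < A" "A < L" "x A \<noteq> y A"
        using LeastI_ex[of "\<lambda>t. s < t \<and> t < L \<and> x t \<noteq> y t"] True by (auto simp: A_def)
      have A_least: "x i = y i" if "s < i" "i < A" for i
        using not_less_Least[of i "\<lambda>t. s < t \<and> t < L \<and> x t \<noteq> y t"] that A by (auto simp: A_def)
      have eq: "\<forall>i<A. i \<noteq> s \<longrightarrow> y i = x i"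
        using A_least s_least by (metis linorder_neqE_nat)
      have uA: "ratio x y A \<noteq> 1" using A ratio_eq_1_iff[OF xy] by simp
      \<comment> \<open>The added summand \<open>k = 0\<close> is an empty sum; the range becomes
        the initial segment that \<open>norm_double_sum_chi_le\<close> treats.\<close>
      have "(\<Sum>k=1..j. ?D k) = (\<Sum>k<Suc j. ?D k)"
        by (rule sum.mono_neutral_left) (auto simp: not_le)
      then have "?F = norm (\<Sum>k<Suc j. ?D k)" by simp
      also have "\<dots> \<le> 2 * real (M (Suc s)) * real (M (Suc A))"
        using A L by (intro norm_double_sum_chi_le[of m "ratio x y", OF m_pos root us uA]) auto
      also have "\<dots> \<le> 2 * (R * real (M s)) * (R * real (M A))"
        by (intro mult_mono M_Suc_le) auto
      also have "\<dots> = 2 * real R ^ 2 * (real (M s) * real (M A))"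
        by (simp add: power2_eq_square)
      also have "\<dots> \<le> 2 * real R ^ 2 * ?W"
        using W[of s A] A eq by (intro mult_left_mono) auto
      finally show ?thesis .
    qed
  qed
qed

definition nbhd :: "nat \<Rightarrow> nat \<Rightarrow> nat \<Rightarrow> (nat \<Rightarrow> nat) \<Rightarrow> (nat \<Rightarrow> nat) set" where
  "nbhd N A s x = {y \<in> pts N. \<forall>i<A. i \<noteq> s \<longrightarrow> y i = x i}"

text \<open>An integral rather than a mean over \<open>S\<close>: the divisor is always
  \<open>M N\<close>, since each point stands for a cell of that mass.\<close>

definition avg :: "nat \<Rightarrow> (nat \<Rightarrow> nat) set \<Rightarrow> ((nat \<Rightarrow> nat) \<Rightarrow> real) \<Rightarrow> real" where
  "avg N S g = 1 / real (M N) * (\<Sum>y\<in>S. g y)"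

lemma finite_nbhd [simp]: "finite (nbhd N A s x)"
  by (simp add: nbhd_def)

lemma avg_nonneg: "(\<And>y. y \<in> S \<Longrightarrow> 0 \<le> g y) \<Longrightarrow> 0 \<le> avg N S g"
  by (simp add: avg_def sum_nonneg)

text \<open>The Fejer kernel bound is inserted into the convolution, and its indicators turn into
  integrals over \<open>nbhd\<close>. All partial sums up to index \<open>M L\<close> come from
  \<open>f L\<close>; keeping this function instead of \<open>f N\<close> makes the later sum over
  \<open>L\<close> possible.\<close>

lemma norm_sum_mart_partial_sum_le:
  assumes f: "is_martingale m \<mu> f" and x: "x \<in> pts N" and L: "L \<le> N" "j \<le> M L"
  shows "norm (\<Sum>k=1..j. mart_partial_sum m \<mu> k f x)
    \<le> 2 * real R ^ 2 * (\<Sum>A\<le>L. \<Sum>s\<le>A. real (M s) * real (M A) * avg N (nbhd N A s x) (\<lambda>y. norm (f L y)))"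
proof -
  let ?b = "\<lambda>A s y. of_bool (\<forall>i<A. i \<noteq> s \<longrightarrow> y i = x i) :: real"
  have "(\<Sum>k=1..j. mart_partial_sum m \<mu> k f x)
      = (\<Sum>k=1..j. (\<Sum>y\<in>pts N. f L y * (\<Sum>i<k. chi N m (ratio x y) i)) / M N)"
  proof (rule sum.cong[OF refl])
    fix k assume k: "k \<in> {1..j}"
    then have "k \<le> M L" "k \<le> M N" using L M_mono[OF L(1)] by auto
    then show "mart_partial_sum m \<mu> k f x = (\<Sum>y\<in>pts N. f L y * (\<Sum>i<k. chi N m (ratio x y) i)) / M N"
      using f level_mono[OF level_martingale[OF f] L(1)]
      by (simp only: mart_partial_sum_eq partial_sum_level)
  qed
  also have "\<dots> = (\<Sum>y\<in>pts N. f L y * (\<Sum>k=1..j. \<Sum>i<k. chi N m (ratio x y) i)) / M N"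
    unfolding sum_divide_distrib[symmetric] sum_distrib_left by (subst sum.swap) simp
  finally have eq: "(\<Sum>k=1..j. mart_partial_sum m \<mu> k f x)
      = (\<Sum>y\<in>pts N. f L y * (\<Sum>k=1..j. \<Sum>i<k. chi N m (ratio x y) i)) / M N" .
  have "norm (\<Sum>k=1..j. mart_partial_sum m \<mu> k f x) \<le> (\<Sum>y\<in>pts N. norm (f L y) * (2 * real R ^ 2 *
      (\<Sum>A\<le>L. \<Sum>s\<le>A. real (M s) * real (M A) * ?b A s y))) / M N"
  proof -
    have "norm (\<Sum>y\<in>pts N. f L y * (\<Sum>k=1..j. \<Sum>i<k. chi N m (ratio x y) i))
        \<le> (\<Sum>y\<in>pts N. norm (f L y) * (2 * real R ^ 2 *
      (\<Sum>A\<le>L. \<Sum>s\<le>A. real (M s) * real (M A) * ?b A s y)))"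
    proof (rule sum_norm_le)
      fix y assume y: "y \<in> pts N"
      show "norm (f L y * (\<Sum>k=1..j. \<Sum>i<k. chi N m (ratio x y) i)) \<le> norm (f L y) * (2 * real R ^ 2 *
          (\<Sum>A\<le>L. \<Sum>s\<le>A. real (M s) * real (M A) * ?b A s y))"
        unfolding norm_mult
        by (rule mult_left_mono[OF norm_fejer_kernel_le[OF pts_Gm[OF x] pts_Gm[OF y] L] norm_ge_zero])
    qed
    then show ?thesis
      unfolding eq norm_divide norm_of_nat by (rule divide_right_mono) simp
  qed
  also have "\<dots> = 2 * real R ^ 2 / real (M N) * (\<Sum>y\<in>pts N. norm (f L y) *
      (\<Sum>A\<le>L. \<Sum>s\<le>A. real (M s) * real (M A) * ?b A s y))"
    unfolding mult.left_commute[of "norm _"] sum_distrib_left[symmetric] by simp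
  also have "\<dots> = 2 * real R ^ 2 / real (M N) * (\<Sum>A\<le>L. \<Sum>s\<le>A. real (M s) * real (M A) *
      (\<Sum>y\<in>pts N. norm (f L y) * ?b A s y))"
    unfolding sum_mult_double_sum ..
  also have "\<dots> = 2 * real R ^ 2 * (\<Sum>A\<le>L. \<Sum>s\<le>A. real (M s) * real (M A) *
      (1 / real (M N) * (\<Sum>y\<in>pts N. norm (f L y) * ?b A s y)))"
    unfolding mult.left_commute[of _ "1 / real (M N)"] sum_distrib_left[symmetric] by simp
  also have "\<dots> = 2 * real R ^ 2 * (\<Sum>A\<le>L. \<Sum>s\<le>A. real (M s) * real (M A) * avg N (nbhd N A s x) (\<lambda>y. norm (f L y)))"
  proof -
    have "(\<Sum>y\<in>pts N. norm (f L y) * ?b A s y) = (\<Sum>y\<in>nbhd N A s x. norm (f L y))" for A s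
      unfolding nbhd_def by (simp add: sum.inter_filter of_bool_def if_distrib cong: if_cong)
    then show ?thesis by (simp only: avg_def)
  qed
  finally show ?thesis .
qed

text \<open>The mean is at most the largest \<open>F j / j\<close> with \<open>j \<le> n\<close>.
  The maximising \<open>j\<close> depends on \<open>x\<close>, so the single term at its level
  \<open>L\<close> is replaced by the sum over all levels with
  \<open>M L \<le> R * n\<close>.\<close>

lemma norlund_mean_powr_le:
  assumes f: "is_martingale m \<mu> f" and x: "x \<in> pts N" and n: "1 \<le> n" "n \<le> M N"
    and q: "\<And>k. 0 \<le> q k" "0 < q 0" "mono q" and p: "0 < p" "p \<le> 1"
  shows "norm (norlund_mean m \<mu> q n f x) powr p \<le> (2 * real R ^ 3) powr p *
    (\<Sum>L | L \<le> N \<and> M L \<le> R * n. real (M L) powr (-p) *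
      (\<Sum>A\<le>L. \<Sum>s\<le>A. real (M s) powr p * real (M A) powr p * avg N (nbhd N A s x) (\<lambda>y. norm (f L y)) powr p))"
proof -
  define F where "F j = norm (\<Sum>k=1..j. mart_partial_sum m \<mu> k f x)" for j
  define V where "V = (MAX j\<in>{1..n}. F j / j)"
  have "V \<in> (\<lambda>j. F j / j) ` {1..n}"
    unfolding V_def using n by (intro Max_in) auto
  then obtain j where j: "1 \<le> j" "j \<le> n" "V = F j / j" by auto
  have Q: "0 < QQ q n"
    unfolding QQ_def using q n by (intro sum_pos2[of _ 0]) auto
  have "norm (\<Sum>k=1..n. q (n - k) *\<^sub>R mart_partial_sum m \<mu> k f x) \<le> QQ q n * V"
  proof (rule norm_weighted_sum_le)
    fix i assume i: "1 \<le> i" "i \<le> n"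
    then have "F i / i \<le> V" unfolding V_def by (intro Max_ge) auto
    then show "norm (\<Sum>k=1..i. mart_partial_sum m \<mu> k f x) \<le> real i * V"
      using i by (simp add: F_def field_simps)
  qed (use q in auto)
  moreover have "norm (norlund_mean m \<mu> q n f x)
      = norm (\<Sum>k=1..n. q (n - k) *\<^sub>R mart_partial_sum m \<mu> k f x) / QQ q n"
    using Q by (simp add: norlund_mean_def norm_divide scaleR_conv_of_real)
  ultimately have t_le: "norm (norlund_mean m \<mu> q n f x) \<le> V"
    using Q by (simp add: pos_divide_le_eq mult.commute)

  \<comment> \<open>Minimality makes \<open>M L\<close> comparable to \<open>j\<close>, with loss at
    most \<open>R\<close>.\<close>
  define L where "L = (LEAST L. j \<le> M L)"
  have jN: "j \<le> M N" using j n by simp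
  have jL: "j \<le> M L" unfolding L_def using jN by (rule LeastI)
  have LN: "L \<le> N" unfolding L_def using jN by (rule Least_le)
  have M_le: "M L \<le> R * j"
  proof (cases L)
    case 0
    then show ?thesis using j R_ge by (simp add: Suc_le_eq)
  next
    case (Suc l)
    then have "M l < j"
      using not_less_Least[of l "\<lambda>L. j \<le> M L"] by (simp add: L_def)
    then have "m l * M l \<le> R * j" using m_le[of l] by (intro mult_mono) auto
    then show ?thesis using Suc by simp
  qed
  let ?a = "\<lambda>L A s. avg N (nbhd N A s x) (\<lambda>y. norm (f L y))"
  have a_nonneg: "0 \<le> ?a L A s" for L A s by (rule avg_nonneg) simp
  let ?G = "\<lambda>L. \<Sum>A\<le>L. \<Sum>s\<le>A. real (M s) powr p * real (M A) powr p * ?a L A s powr p"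
  have G_nonneg: "0 \<le> ?G L" for L by (intro sum_nonneg) auto
  have "V \<le> (2 * real R ^ 2 * (\<Sum>A\<le>L. \<Sum>s\<le>A. real (M s) * real (M A) * ?a L A s)) / j"
    unfolding j(3) F_def
    by (intro divide_right_mono norm_sum_mart_partial_sum_le[OF f x LN jL]) simp
  \<comment> \<open>Replacing \<open>j\<close> by \<open>M L / R\<close> contributes the third
    factor \<open>R\<close>; the kernel bound supplied the other two.\<close>
  also have "\<dots> \<le> (2 * real R ^ 2 * (\<Sum>A\<le>L. \<Sum>s\<le>A. real (M s) * real (M A) * ?a L A s)) / (M L / R)"
  proof (rule divide_left_mono)
    have "real (M L) \<le> R * real j" using M_le by (metis of_nat_le_iff of_nat_mult)
    then show "real (M L) / R \<le> j" using R_ge by (simp add: field_simps)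
    show "0 \<le> 2 * real R ^ 2 * (\<Sum>A\<le>L. \<Sum>s\<le>A. real (M s) * real (M A) * ?a L A s)"
      using a_nonneg by (intro mult_nonneg_nonneg sum_nonneg) auto
    show "0 < real j * (real (M L) / real R)"
      using j M_pos[of L] R_ge by (intro mult_pos_pos divide_pos_pos) auto
  qed
  also have "\<dots> = (2 * real R ^ 3) * (inverse (real (M L)) * (\<Sum>A\<le>L. \<Sum>s\<le>A. real (M s) * real (M A) * ?a L A s))"
    by (simp add: field_simps power2_eq_square power3_eq_cube)
  finally have "V powr p \<le> \<dots> powr p"
    using p j by (intro powr_mono2) (auto simp: F_def)
  also have "\<dots> = (2 * real R ^ 3) powr p * (real (M L) powr (-p) *
      (\<Sum>A\<le>L. \<Sum>s\<le>A. real (M s) * real (M A) * ?a L A s) powr p)"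
    using a_nonneg by (simp add: powr_mult sum_nonneg powr_minus inverse_powr)
  also have "\<dots> \<le> (2 * real R ^ 3) powr p * (real (M L) powr (-p) * ?G L)"
  proof (intro mult_left_mono)
    have "(\<Sum>A\<le>L. \<Sum>s\<le>A. real (M s) * real (M A) * ?a L A s) powr p
        \<le> (\<Sum>A\<le>L. (\<Sum>s\<le>A. real (M s) * real (M A) * ?a L A s) powr p)"
      using p a_nonneg by (intro powr_sum_le_sum_powr) (auto intro!: sum_nonneg)
    also have "\<dots> \<le> (\<Sum>A\<le>L. \<Sum>s\<le>A. (real (M s) * real (M A) * ?a L A s) powr p)"
      using p a_nonneg by (intro sum_mono powr_sum_le_sum_powr) auto
    also have "\<dots> = ?G L"
      using a_nonneg by (simp add: powr_mult)
    finally show "(\<Sum>A\<le>L. \<Sum>s\<le>A. real (M s) * real (M A) * ?a L A s) powr p \<le> ?G L" .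
  qed auto
  also have "\<dots> \<le> (2 * real R ^ 3) powr p *
      (\<Sum>L | L \<le> N \<and> M L \<le> R * n. real (M L) powr (-p) * ?G L)"
  proof (intro mult_left_mono member_le_sum)
    have "R * j \<le> R * n" using j by simp
    with M_le have "M L \<le> R * n" by (rule order_trans)
    then show "L \<in> {L. L \<le> N \<and> M L \<le> R * n}" using LN by simp
  qed (use G_nonneg in auto)
  finally have "V powr p \<le> \<dots>" .
  moreover have "norm (norlund_mean m \<mu> q n f x) powr p \<le> V powr p"
    using t_le p by (intro powr_mono2) auto
  ultimately show ?thesis by linarith
qed

section \<open>Summation over indices, levels and neighbourhoods\<close>

lemma nbhd_sym: "x \<in> pts N \<Longrightarrow> y \<in> pts N \<Longrightarrow> y \<in> nbhd N A s x \<longleftrightarrow> x \<in> nbhd N A s y"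
  by (auto simp: nbhd_def)

lemma card_nbhd_le:
  assumes "y \<in> pts N" "A \<le> N"
  shows "real (card (nbhd N A s y)) / M N \<le> R / M A"
proof -
  have "real (card (nbhd N A s y) * M A) \<le> real (R * M N)"
    using card_pts_cell_except[OF pts_Gm[OF assms(1)] assms(2)] by (simp only: of_nat_le_iff nbhd_def)
  then show ?thesis
    using M_pos[of N] M_pos[of A] by (simp add: field_simps)
qed

text \<open>The inequality \<open>sum_powr_average_le\<close> on one neighbourhood. As
  \<open>L \<ge> A\<close>, it contains with each point the whole cell of level \<open>L\<close>, on
  which \<open>f L\<close> is constant; this gives the lower bound on level sets.\<close>

lemma sum_avg_nbhd_powr_le:
  assumes f: "is_martingale m \<mu> f" and x: "x \<in> pts N" and p: "0 < p" "p < 1"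
    and \<phi>: "\<And>L y. L \<le> N \<Longrightarrow> y \<in> pts N \<Longrightarrow> norm (f L y) \<le> \<phi> y"
  shows "(\<Sum>L=A..N. real (M L) powr (p - 1) * avg N (nbhd N A s x) (\<lambda>y. norm (f L y)) powr p)
    \<le> 2 powr p / (1 - 2 powr (p - 1)) / (1 - 2 powr (-p)) * avg N (nbhd N A s x) (\<lambda>y. \<phi> y powr p)"
  unfolding avg_def
proof (rule sum_powr_average_le)
  show "0 \<le> \<phi> y" if "y \<in> nbhd N A s x" for y
    using that \<phi>[of N y] by (auto simp: nbhd_def intro: order_trans[OF norm_ge_zero])
  fix L y assume L: "L \<in> {A..N}" and y: "y \<in> nbhd N A s x"
  let ?E = "{z \<in> pts N. \<forall>i<L. z i = y i}"
  have yN: "y \<in> pts N" using y by (simp add: nbhd_def)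
  have "?E \<subseteq> {z \<in> nbhd N A s x. norm (f L z) = norm (f L y)}"
  proof (intro subsetI CollectI conjI)
    fix z assume z: "z \<in> ?E"
    then show "z \<in> nbhd N A s x" using y L by (auto simp: nbhd_def)
    have "f L z = f L y"
      using z yN by (intro levelD[OF level_martingale[OF f] pts_Gm pts_Gm]) auto
    then show "norm (f L z) = norm (f L y)" by simp
  qed
  then have le: "card ?E \<le> card {z \<in> nbhd N A s x. norm (f L z) = norm (f L y)}"
    by (intro card_mono) auto
  have "real (card ?E * M L) = real (M N)"
    using card_pts_cell[OF pts_Gm[OF yN], of L N] L by (simp only: atLeastAtMost_iff)
  then have "1 / real (M L) = 1 / real (M N) * card ?E"
    using M_pos[of N] M_pos[of L] by (simp add: field_simps)
  also have "\<dots> \<le> 1 / real (M N) * card {z \<in> nbhd N A s x. norm (f L z) = norm (f L y)}"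
    using le by (intro mult_left_mono) auto
  finally show "1 / real (M L) \<le> 1 / real (M N) * card {z \<in> nbhd N A s x. norm (f L z) = norm (f L y)}" .
qed (use p M_pos M_double \<phi> in \<open>auto simp: nbhd_def\<close>)

text \<open>The factors are, in order, the losses in the pointwise bound, the tail sum over
  \<open>n\<close>, the averaging inequality, the measure of a neighbourhood, and the geometric sums
  over \<open>s\<close> and \<open>A\<close>. The last denominator is positive only for
  \<open>p < 1 / 2\<close>.\<close>

definition Cp :: "real \<Rightarrow> real" where
  "Cp p = (2 * real R ^ 3) powr p * (2 powr (2 - 2 * p) / (1 - 2 * p) * real R powr (1 - 2 * p)) *
     (2 powr p / (1 - 2 powr (p - 1)) / (1 - 2 powr (-p))) * R / (1 - 2 powr (-p)) / (1 - 2 powr (2 * p - 1))"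

text \<open>The bound is uniform in \<open>N\<close>, which is both the truncation of the series and
  the resolution of the points. Sums are evaluated in the order \<open>n\<close>, \<open>L\<close>,
  \<open>x\<close>, \<open>s\<close>, \<open>A\<close>.\<close>

lemma sum_avg_norlund_mean_le:
  assumes f: "is_martingale m \<mu> f" and p: "0 < p" "p < 1 / 2"
    and q: "\<And>k. 0 \<le> q k" "0 < q 0" "mono q"
    and \<phi>: "\<And>L y. L \<le> N \<Longrightarrow> y \<in> pts N \<Longrightarrow> norm (f L y) \<le> \<phi> y"
  shows "(\<Sum>n=1..N. real n powr (2 * p - 2) * avg N (pts N) (\<lambda>x. norm (norlund_mean m \<mu> q n f x) powr p))
    \<le> Cp p * avg N (pts N) (\<lambda>y. \<phi> y powr p)"
proof -
  define C1 where "C1 = (2 * real R ^ 3) powr p"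
  define C2 where "C2 = 2 powr (2 - 2 * p) / (1 - 2 * p) * real R powr (1 - 2 * p)"
  define C3 where "C3 = 2 powr p / (1 - 2 powr (p - 1)) / (1 - 2 powr (-p))"
  define a where "a L A s x = avg N (nbhd N A s x) (\<lambda>y. norm (f L y)) powr p" for L A s x
  define b where "b A s x = avg N (nbhd N A s x) (\<lambda>y. \<phi> y powr p)" for A s x
  define G where "G L x = (\<Sum>A\<le>L. \<Sum>s\<le>A. real (M s) powr p * real (M A) powr p * a L A s x)" for L x
  have pow: "2 powr (p - 1) < (1::real)" "2 powr (-p) < (1::real)" "2 powr (2 * p - 1) < (1::real)"
    using p by (simp_all add: powr_less_one)
  have C: "0 \<le> C1" "0 \<le> C2" "0 \<le> C3"
    using p pow by (simp_all add: C1_def C2_def C3_def)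
  have G_nonneg: "0 \<le> G L x" for L x
    unfolding G_def a_def by (intro sum_nonneg) auto
  \<comment> \<open>Since \<open>2 * p - 2 = - (1 - 2 * p) - 1\<close>, the tail estimate applies
    with \<open>a = 1 - 2 * p\<close> from the starting point \<open>M L / R\<close>.\<close>
  have tail: "(\<Sum>n | n \<in> {1..N} \<and> M L \<le> R * n. real n powr (2 * p - 2)) \<le> C2 * real (M L) powr (2 * p - 1)" for L
  proof -
    have "(\<Sum>n | n \<in> {1..N} \<and> M L \<le> R * n. real n powr (- (1 - 2 * p) - 1))
        \<le> 2 powr ((1 - 2 * p) + 1) / (1 - 2 * p) * (M L / R) powr (- (1 - 2 * p))"
    proof (rule sum_powr_neg_tail_le)
      fix n assume "n \<in> {n. n \<in> {1..N} \<and> M L \<le> R * n}"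
      then have "0 < n" "real (M L) \<le> R * real n" by (auto simp flip: of_nat_mult)
      then show "0 < n \<and> M L / R \<le> real n" using R_ge by (simp add: field_simps)
    qed (use p M_pos[of L] R_ge in auto)
    also have "(M L / R) powr (- (1 - 2 * p)) = real (M L) powr (2 * p - 1) * real R powr (1 - 2 * p)"
      using R_ge powr_minus_divide[of "real R" "1 - 2 * p"] by (simp add: powr_divide)
    finally show ?thesis by (simp add: C2_def mult_ac)
  qed

  \<comment> \<open>The powers of \<open>M L\<close> combine to \<open>M L powr (p - 1)\<close>, the
    weight of the averaging inequality; exchanging sums makes the sum over \<open>L \<ge> A\<close>
    innermost.\<close>
  have swap: "(\<Sum>L\<le>N. real (M L) powr (-p) * G L x * (C2 * real (M L) powr (2 * p - 1)))
      = C2 * (\<Sum>A\<le>N. \<Sum>s\<le>A. real (M s) powr p * real (M A) powr p * (\<Sum>L=A..N. real (M L) powr (p - 1) * a L A s x))" for x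
  proof -
    have eq: "(\<Sum>L\<le>N. real (M L) powr (-p) * G L x * (C2 * real (M L) powr (2 * p - 1)))
        = C2 * (\<Sum>L\<le>N. real (M L) powr (p - 1) * G L x)"
      unfolding sum_distrib_left
    proof (intro sum.cong refl)
      fix L
      have "real (M L) powr (-p) * real (M L) powr (2 * p - 1) = real (M L) powr (p - 1)"
        by (simp add: powr_add[symmetric])
      then show "real (M L) powr (-p) * G L x * (C2 * real (M L) powr (2 * p - 1)) = C2 * (real (M L) powr (p - 1) * G L x)"
        by (metis mult.assoc mult.commute)
    qed
    have "(\<Sum>L\<le>N. real (M L) powr (p - 1) * G L x) = (\<Sum>L\<in>{..N}. \<Sum>A | A \<in> {..N} \<and> A \<le> L.
        \<Sum>s\<le>A. real (M s) powr p * real (M A) powr p * (real (M L) powr (p - 1) * a L A s x))"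
      unfolding G_def sum_distrib_left
    proof (intro sum.cong[OF refl] sum.cong)
      show "{..L} = {A \<in> {..N}. A \<le> L}" if "L \<in> {..N}" for L using that by auto
    qed (simp add: mult_ac)
    also have "\<dots> = (\<Sum>A\<in>{..N}. \<Sum>L | L \<in> {..N} \<and> A \<le> L.
        \<Sum>s\<le>A. real (M s) powr p * real (M A) powr p * (real (M L) powr (p - 1) * a L A s x))"
      by (rule sum.swap_restrict) auto
    also have "\<dots> = (\<Sum>A\<le>N. \<Sum>s\<le>A. real (M s) powr p * real (M A) powr p * (\<Sum>L=A..N. real (M L) powr (p - 1) * a L A s x))"
      unfolding sum_distrib_left by (subst sum.swap) (auto intro!: sum.cong)
    finally show ?thesis unfolding eq by (rule arg_cong)
  qed

  have "(\<Sum>n=1..N. real n powr (2 * p - 2) * avg N (pts N) (\<lambda>x. norm (norlund_mean m \<mu> q n f x) powr p))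
      \<le> (\<Sum>n=1..N. real n powr (2 * p - 2) * avg N (pts N) (\<lambda>x. C1 *
          (\<Sum>L | L \<in> {..N} \<and> M L \<le> R * n. real (M L) powr (-p) * G L x)))"
  proof (intro sum_mono mult_left_mono)
    fix n assume n: "n \<in> {1..N}"
    then have "n \<le> M N" using le_M[of N] by simp
    then show "avg N (pts N) (\<lambda>x. norm (norlund_mean m \<mu> q n f x) powr p)
      \<le> avg N (pts N) (\<lambda>x. C1 * (\<Sum>L | L \<in> {..N} \<and> M L \<le> R * n. real (M L) powr (-p) * G L x))"
      unfolding avg_def[of N "pts N"] using n p q norlund_mean_powr_le[OF f _ _ _ q, of _ N n p]
      by (intro mult_left_mono sum_mono) (auto simp: C1_def G_def a_def)
  qed simp
  also have "\<dots> = C1 * avg N (pts N) (\<lambda>x. \<Sum>n=1..N. \<Sum>L | L \<in> {..N} \<and> M L \<le> R * n.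
      real n powr (2 * p - 2) * (real (M L) powr (-p) * G L x))"
    unfolding avg_def sum_distrib_left by (subst sum.swap) (simp add: mult_ac)
  also have "\<dots> = C1 * avg N (pts N) (\<lambda>x. \<Sum>L\<le>N. real (M L) powr (-p) * G L x *
      (\<Sum>n | n \<in> {1..N} \<and> M L \<le> R * n. real n powr (2 * p - 2)))"
    unfolding sum_distrib_left by (subst sum.swap_restrict) (simp_all add: mult_ac)
  also have "\<dots> \<le> C1 * avg N (pts N) (\<lambda>x. \<Sum>L\<le>N. real (M L) powr (-p) * G L x * (C2 * real (M L) powr (2 * p - 1)))"
    unfolding avg_def using C G_nonneg by (intro mult_left_mono sum_mono tail) auto
  also have "\<dots> = C1 * avg N (pts N) (\<lambda>x. C2 *
      (\<Sum>A\<le>N. \<Sum>s\<le>A. real (M s) powr p * real (M A) powr p * (\<Sum>L=A..N. real (M L) powr (p - 1) * a L A s x)))"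
    by (simp only: swap)
  also have "\<dots> \<le> C1 * avg N (pts N) (\<lambda>x. C2 *
      (\<Sum>A\<le>N. \<Sum>s\<le>A. real (M s) powr p * real (M A) powr p * (C3 * b A s x)))"
    unfolding avg_def[of N "pts N"]
  proof (intro mult_left_mono sum_mono C)
    fix x A s assume x: "x \<in> pts N"
    have "p < 1" using p by simp
    from sum_avg_nbhd_powr_le[OF f x p(1) this \<phi>]
    show "(\<Sum>L=A..N. real (M L) powr (p - 1) * a L A s x) \<le> C3 * b A s x"
      by (simp add: a_def b_def C3_def)
  qed auto
  also have "\<dots> = C1 * C2 * C3 * (\<Sum>A\<le>N. \<Sum>s\<le>A. real (M s) powr p * real (M A) powr p * avg N (pts N) (b A s))"
  proof -
    have "C1 * avg N (pts N) (\<lambda>x. C2 * (\<Sum>A\<le>N. \<Sum>s\<le>A. real (M s) powr p * real (M A) powr p * (C3 * b A s x)))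
        = (\<Sum>x\<in>pts N. C1 * C2 * C3 / M N * (\<Sum>A\<le>N. \<Sum>s\<le>A. real (M s) powr p * real (M A) powr p * b A s x))"
      unfolding avg_def mult.left_commute[of _ C3] sum_distrib_left[symmetric] by simp
    also have "\<dots> = (\<Sum>A\<le>N. \<Sum>s\<le>A. real (M s) powr p * real (M A) powr p * (C1 * C2 * C3 * avg N (pts N) (b A s)))"
      unfolding sum_mult_double_sum unfolding avg_def sum_distrib_left[symmetric] by simp
    also have "\<dots> = C1 * C2 * C3 * (\<Sum>A\<le>N. \<Sum>s\<le>A. real (M s) powr p * real (M A) powr p * avg N (pts N) (b A s))"
      unfolding mult.left_commute[of _ "C1 * C2 * C3"] sum_distrib_left[symmetric] ..
    finally show ?thesis .
  qed
  also have "\<dots> \<le> C1 * C2 * C3 * (\<Sum>A\<le>N. \<Sum>s\<le>A. real (M s) powr p * real (M A) powr p *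
      (R / M A * avg N (pts N) (\<lambda>y. \<phi> y powr p)))"
  proof (intro mult_left_mono sum_mono)
    fix A s assume A: "A \<in> {..N}"
    \<comment> \<open>By symmetry, the points \<open>x\<close> whose neighbourhood contains a fixed
      \<open>y\<close> form the neighbourhood of \<open>y\<close>, of measure at most
      \<open>R / M A\<close>.\<close>
    have "avg N (pts N) (b A s) = 1 / M N * (\<Sum>x\<in>pts N. 1 / M N * (\<Sum>y | y \<in> pts N \<and> y \<in> nbhd N A s x. \<phi> y powr p))"
      by (simp add: avg_def b_def nbhd_def)
    also have "\<dots> = 1 / M N * (\<Sum>x\<in>pts N. \<Sum>y | y \<in> pts N \<and> y \<in> nbhd N A s x. 1 / M N * \<phi> y powr p)"
      by (simp only: sum_distrib_left)
    also have "\<dots> = 1 / M N * (\<Sum>y\<in>pts N. \<Sum>x | x \<in> pts N \<and> y \<in> nbhd N A s x. 1 / M N * \<phi> y powr p)"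
      by (subst sum.swap_restrict) auto
    also have "\<dots> = 1 / M N * (\<Sum>y\<in>pts N. real (card (nbhd N A s y)) / M N * \<phi> y powr p)"
    proof -
      have "{x. x \<in> pts N \<and> y \<in> nbhd N A s x} = nbhd N A s y" if "y \<in> pts N" for y
        using that nbhd_sym[of _ N y A s] by (auto simp: nbhd_def)
      then show ?thesis by simp
    qed
    also have "\<dots> \<le> 1 / M N * (\<Sum>y\<in>pts N. R / M A * \<phi> y powr p)"
      using A by (intro mult_left_mono sum_mono mult_right_mono card_nbhd_le) auto
    also have "\<dots> = R / M A * avg N (pts N) (\<lambda>y. \<phi> y powr p)"
      by (simp add: avg_def sum_distrib_left mult_ac)
    finally show "avg N (pts N) (b A s) \<le> R / M A * avg N (pts N) (\<lambda>y. \<phi> y powr p)" .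
  qed (use C in auto)
  also have "\<dots> = C1 * C2 * C3 * R * avg N (pts N) (\<lambda>y. \<phi> y powr p) *
      (\<Sum>A\<le>N. real (M A) powr (p - 1) * (\<Sum>s\<le>A. real (M s) powr p))"
    using M_pos by (simp add: sum_distrib_left sum_divide_distrib powr_diff mult_ac)
  also have "\<dots> \<le> C1 * C2 * C3 * R * avg N (pts N) (\<lambda>y. \<phi> y powr p) *
      (1 / (1 - 2 powr (-p)) / (1 - 2 powr (2 * p - 1)))"
  proof (intro mult_left_mono)
    \<comment> \<open>The sum over \<open>s\<close> is of order \<open>M A powr p\<close>. With the
      weight this leaves the negative power \<open>2 * p - 1\<close> of \<open>M A\<close>, and the
      sum over \<open>A\<close> is dominated by a geometric series starting from
      \<open>M 0 = 1\<close>.\<close>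
    have "(\<Sum>A\<le>N. real (M A) powr (p - 1) * (\<Sum>s\<le>A. real (M s) powr p))
        \<le> (\<Sum>A\<le>N. real (M A) powr (p - 1) * (real (M A) powr p / (1 - 2 powr (-p))))"
      using p M_pos M_double M_mono
      by (intro sum_mono mult_left_mono sum_powr_doubling_le) auto
    also have "\<dots> = (\<Sum>A\<le>N. real (M A) powr (-(1 - 2 * p))) / (1 - 2 powr (-p))"
      by (simp add: sum_divide_distrib powr_add[symmetric])
    also have "\<dots> \<le> (1 powr (-(1 - 2 * p)) / (1 - 2 powr (-(1 - 2 * p)))) / (1 - 2 powr (-p))"
      using p M_pos M_double pow
      by (intro divide_right_mono sum_powr_neg_doubling_le) (auto simp: Suc_le_eq)
    also have "\<dots> = 1 / (1 - 2 powr (-p)) / (1 - 2 powr (2 * p - 1))"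
      by simp
    finally show "(\<Sum>A\<le>N. real (M A) powr (p - 1) * (\<Sum>s\<le>A. real (M s) powr p))
        \<le> 1 / (1 - 2 powr (-p)) / (1 - 2 powr (2 * p - 1))" .
  qed (use C in \<open>auto intro!: mult_nonneg_nonneg avg_nonneg\<close>)
  also have "\<dots> = Cp p * avg N (pts N) (\<lambda>y. \<phi> y powr p)"
    by (simp add: Cp_def C1_def C2_def C3_def)
  finally show ?thesis .
qed

lemma Cp_pos: "0 < Cp p" if "0 < p" "p < 1 / 2"
proof -
  have "2 powr (p - 1) < (1::real)" "2 powr (-p) < (1::real)" "2 powr (2 * p - 1) < (1::real)"
    using that by (simp_all add: powr_less_one)
  then show ?thesis
    unfolding Cp_def using that R_ge by (intro divide_pos_pos mult_pos_pos) auto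
qed

end

section \<open>Passage to extended-valued quasi-norms\<close>

lemma epowr_ennreal: "0 \<le> t \<Longrightarrow> epowr (ennreal t) s = ennreal (t powr s)"
  by (simp add: epowr_def)

lemma epowr_mono: "epowr a s \<le> epowr b s" if "a \<le> b" "0 \<le> s"
proof (cases "b = \<infinity>")
  case False
  then obtain y where y: "0 \<le> y" "b = ennreal y" by (cases b) auto
  then obtain x where "0 \<le> x" "a = ennreal x"
    using \<open>a \<le> b\<close> by (cases a) (auto simp: top_unique)
  with y show ?thesis
    using \<open>a \<le> b\<close> \<open>0 \<le> s\<close> by (auto simp: epowr_ennreal intro: powr_mono2)
qed (simp add: epowr_def)

text \<open>The exponents \<open>1 / p\<close> and \<open>p\<close> cancel, also at
  infinity.\<close>

lemma epowr_Lp_enorm: "epowr (Lp_enorm \<mu> p g) p = (\<integral>\<^sup>+x. epowr (g x) p \<partial>\<mu>)" if "0 < p"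
proof -
  have "epowr (epowr a (1 / p)) p = a" for a
    using that by (cases a) (auto simp: epowr_ennreal powr_powr epowr_def)
  then show ?thesis by (simp add: Lp_enorm_def)
qed

context vilenkin begin

lemma nn_integral_level_avg:
  assumes "level N g" "\<And>y. 0 \<le> g y"
  shows "(\<integral>\<^sup>+y. ennreal (g y) \<partial>\<mu>) = ennreal (avg N (pts N) g)"
proof -
  have "level N (\<lambda>y. ennreal (g y))"
    using assms(1) unfolding level_def by metis
  then have "(\<integral>\<^sup>+y. ennreal (g y) \<partial>\<mu>) = (\<Sum>y\<in>pts N. ennreal (g y) * ennreal (1 / M N))"
    by (rule nn_integral_level)
  also have "\<dots> = (\<Sum>y\<in>pts N. ennreal (1 / M N * g y))"
    using assms(2) by (simp add: ennreal_mult'[symmetric])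
  also have "\<dots> = ennreal (avg N (pts N) g)"
    unfolding avg_def sum_distrib_left using assms(2) by (intro sum_ennreal) simp
  finally show ?thesis .
qed

lemma level_norlund_mean:
  assumes "n \<le> M N"
  shows "level N (norlund_mean m \<mu> q n f)"
  unfolding level_def
proof (intro ballI impI)
  fix x y assume xy: "x \<in> Gm m" "y \<in> Gm m" "\<forall>k<N. x k = y k"
  have "psi m i x = psi m i y" if "i < M N" for i
    using xy by (intro levelD[OF level_psi[OF that]]) auto
  then have "mart_partial_sum m \<mu> k f x = mart_partial_sum m \<mu> k f y" if "k \<le> n" for k
    using that assms by (simp add: mart_partial_sum_def)
  then show "norlund_mean m \<mu> q n f x = norlund_mean m \<mu> q n f y"
    by (simp add: norlund_mean_def)
qed

lemma epowr_Lp_norm_norlund_mean: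
  assumes "n \<le> M N" "0 < p"
  shows "epowr (Lp_norm \<mu> p (norlund_mean m \<mu> q n f)) p
    = ennreal (avg N (pts N) (\<lambda>x. norm (norlund_mean m \<mu> q n f x) powr p))"
proof -
  have "level N (\<lambda>x. norm (norlund_mean m \<mu> q n f x) powr p)"
    using level_norlund_mean[OF assms(1), of q f] unfolding level_def by metis
  then show ?thesis
    using assms(2) by (simp add: Lp_norm_def epowr_Lp_enorm epowr_ennreal nn_integral_level_avg)
qed

text \<open>The maximum over \<open>L \<le> N\<close> is constant on cells of level
  \<open>N\<close>, so its average is an integral, and pointwise it is at most the maximal
  function.\<close>

lemma avg_Max_le_Hp_norm:
  assumes f: "is_martingale m \<mu> f" and p: "0 < p"
  shows "ennreal (avg N (pts N) (\<lambda>y. (MAX L\<in>{..N}. norm (f L y)) powr p)) \<le> epowr (Hp_norm \<mu> p f) p"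
proof -
  define \<phi> where "\<phi> y = (MAX L\<in>{..N}. norm (f L y))" for y
  have \<phi>_in: "\<phi> y \<in> (\<lambda>L. norm (f L y)) ` {..N}" for y
    unfolding \<phi>_def by (intro Max_in) auto
  have lev: "level N (\<lambda>y. \<phi> y powr p)"
    unfolding level_def
  proof (intro ballI impI)
    fix x y assume "x \<in> Gm m" "y \<in> Gm m" "\<forall>k<N. x k = y k"
    then have "f L x = f L y" if "L \<le> N" for L
      using that by (intro levelD[OF level_martingale[OF f, of L]]) auto
    then have "(\<lambda>L. norm (f L x)) ` {..N} = (\<lambda>L. norm (f L y)) ` {..N}"
      by (intro image_cong) auto
    then show "\<phi> x powr p = \<phi> y powr p" by (simp add: \<phi>_def)
  qed
  have "ennreal (avg N (pts N) (\<lambda>y. \<phi> y powr p)) = (\<integral>\<^sup>+y. ennreal (\<phi> y powr p) \<partial>\<mu>)"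
    by (rule nn_integral_level_avg[OF lev, symmetric]) simp
  also have "\<dots> \<le> (\<integral>\<^sup>+y. epowr (maximal_fun f y) p \<partial>\<mu>)"
  proof (intro nn_integral_mono)
    fix y
    obtain L where L: "\<phi> y = norm (f L y)" using \<phi>_in by blast
    then have "ennreal (\<phi> y) \<le> maximal_fun f y"
      unfolding maximal_fun_def L by (intro SUP_upper) simp
    then have "epowr (ennreal (\<phi> y)) p \<le> epowr (maximal_fun f y) p"
      using p by (intro epowr_mono) auto
    then show "ennreal (\<phi> y powr p) \<le> epowr (maximal_fun f y) p"
      using L by (simp add: epowr_ennreal)
  qed
  also have "\<dots> = epowr (Hp_norm \<mu> p f) p"
    using p by (simp add: Hp_norm_def epowr_Lp_enorm)
  finally show ?thesis by (simp add: \<phi>_def)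
qed

text \<open>Truncating both the series and the maximal function at \<open>N\<close> reduces the
  claim to \<open>sum_avg_norlund_mean_le\<close>.\<close>

lemma sum_Lp_norm_norlund_mean_le:
  assumes f: "is_martingale m \<mu> f" and p: "0 < p" "p < 1 / 2"
    and q: "\<And>k. 0 \<le> q k" "0 < q 0" "mono q"
  shows "(\<Sum>k<N. epowr (Lp_norm \<mu> p (norlund_mean m \<mu> q (Suc k) f)) p / ennreal (real (Suc k) powr (2 - 2 * p)))
    \<le> ennreal (Cp p) * epowr (Hp_norm \<mu> p f) p"
proof -
  let ?t = "\<lambda>n. avg N (pts N) (\<lambda>x. norm (norlund_mean m \<mu> q n f x) powr p)"
  let ?\<phi> = "\<lambda>y. MAX L\<in>{..N}. norm (f L y)"
  have "(\<Sum>k<N. epowr (Lp_norm \<mu> p (norlund_mean m \<mu> q (Suc k) f)) p / ennreal (real (Suc k) powr (2 - 2 * p)))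
      = (\<Sum>k<N. ennreal (real (Suc k) powr (2 * p - 2) * ?t (Suc k)))"
  proof (intro sum.cong refl)
    fix k assume "k \<in> {..<N}"
    then have "Suc k \<le> M N" using le_M[of N] by simp
    have "?t (Suc k) / real (Suc k) powr (2 - 2 * p) = real (Suc k) powr (2 * p - 2) * ?t (Suc k)"
      using powr_minus_divide[of "real (Suc k)" "2 - 2 * p"] by simp
    then show "epowr (Lp_norm \<mu> p (norlund_mean m \<mu> q (Suc k) f)) p / ennreal (real (Suc k) powr (2 - 2 * p))
        = ennreal (real (Suc k) powr (2 * p - 2) * ?t (Suc k))"
      using epowr_Lp_norm_norlund_mean[OF \<open>Suc k \<le> M N\<close> p(1), of q f]
        divide_ennreal[of "?t (Suc k)" "real (Suc k) powr (2 - 2 * p)"]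
      by (simp add: avg_nonneg del: of_nat_Suc)
  qed
  also have "\<dots> = ennreal (\<Sum>n=1..N. real n powr (2 * p - 2) * ?t n)"
    by (subst sum_ennreal)
      (auto intro!: mult_nonneg_nonneg avg_nonneg arg_cong[of _ _ ennreal] sum.reindex_bij_witness[of _ "\<lambda>n. n - 1" Suc])
  also have "\<dots> \<le> ennreal (Cp p * avg N (pts N) (\<lambda>y. ?\<phi> y powr p))"
    by (intro ennreal_leI sum_avg_norlund_mean_le[OF f p q]) (auto intro!: Max_ge)
  also have "\<dots> = ennreal (Cp p) * ennreal (avg N (pts N) (\<lambda>y. ?\<phi> y powr p))"
    using Cp_pos[OF p] by (intro ennreal_mult) (auto intro: avg_nonneg)
  also have "\<dots> \<le> ennreal (Cp p) * epowr (Hp_norm \<mu> p f) p"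
    by (intro mult_left_mono avg_Max_le_Hp_norm[OF f p(1)]) simp
  finally show ?thesis .
qed

end

theorem theorem4p21:
  fixes m :: "nat \<Rightarrow> nat" and \<mu> :: "(nat \<Rightarrow> nat) measure" and p :: real
  assumes m_ge: "\<And>k. m k \<ge> 2"
    and m_bdd: "bdd_above (range m)"
    and haar: "normalized_haar m \<mu>"
    and p: "0 < p" "p < 1 / 2"
  shows "\<exists>c::real. c > 0 \<and>
    (\<forall>(q :: nat \<Rightarrow> real) f.
       (\<forall>k. q k \<ge> 0) \<longrightarrow> q 0 > 0 \<longrightarrow> filterlim (QQ q) at_top sequentially \<longrightarrow> mono q \<longrightarrow>
       f \<in> Hp m \<mu> p \<longrightarrow>
       (\<Sum>k. epowr (Lp_norm \<mu> p (norlund_mean m \<mu> q (Suc k) f)) p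
              / ennreal (real (Suc k) powr (2 - 2 * p)))
         \<le> ennreal c * epowr (Hp_norm \<mu> p f) p)"
proof -
  obtain R where "\<And>k. m k \<le> R"
    using m_bdd by (auto simp: bdd_above_def)
  then interpret vilenkin m \<mu> R
    using m_ge haar by unfold_locales
  show ?thesis
  proof (intro exI[of _ "Cp p"] conjI allI impI)
    show "0 < Cp p" using p by (rule Cp_pos)
    fix q :: "nat \<Rightarrow> real" and f
    assume "\<forall>k. 0 \<le> q k" "0 < q 0" "mono q" "f \<in> Hp m \<mu> p"
    \<comment> \<open>The series is the supremum of its partial sums, which all obey the same
      bound.\<close>
    then show "(\<Sum>k. epowr (Lp_norm \<mu> p (norlund_mean m \<mu> q (Suc k) f)) p
        / ennreal (real (Suc k) powr (2 - 2 * p))) \<le> ennreal (Cp p) * epowr (Hp_norm \<mu> p f) p"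
      unfolding suminf_eq_SUP
      by (intro SUP_least sum_Lp_norm_norlund_mean_le p) (auto simp: Hp_def)
  qed
qed

end
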